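(* Let $p\in[1,\infty]$ and let $N:\mathbb R\to\mathbb R$ be a Young function with $C_N=\sup_{x>0}\frac{xN'(x)}{N(x)}<\infty$. For all random variables $F$ on $\Omega$ with $m(F)=0$, $$\|F\|_N\le\frac{C_N}{k_p^+}\left\|\,|DF|_{L^p(\frac{\sigma+\omega}2)}\right\|_N$$ and $$E[N(F)]\le E\left[N\left(\frac{C_N}{k_p^+}|DF|_{L^p(\frac{\sigma+\omega}2)}\right)\right].$$
   Context: $X$ is a metric space with Borel $\sigma$-algebra $\mathcal B(X)$ and $\sigma$ is a finite diffuse (atomless) measure on $X$. $\Omega$ is the set of Radon measures $\omega=\sum_{i=1}^N\delta_{x_i}$ with pairwise distinct $x_i\in X$, finitely or infinitely many points; $\omega$ is identified with the set $\{x_1,x_2,\dots\}$. $\mathcal F$ is the $\sigma$-algebra generated by the maps $\omega\mapsto\omega(B)$, $B\in\mathcal B(X)$, and $\pi$ is the Poisson measure on $(\Omega,\mathcal F)$ with intensity $\sigma$; $E$ is expectation under $\pi$. $m(F)$ denotes a median of $F$ under $\pi$. $D_xF(\omega)=(F(\omega)-F(\omega+\delta_x))1_{\{x\notin\omega\}}+(F(\omega)-F(\omega-\delta_x))1_{\{x\in\omega\}}$, $D_x^+F=\max(0,D_xF)$. For each $\omega$, $|DF(\omega)|_{L^p(\frac{\sigma+\omega}2)}$ and $|D^+F(\omega)|_{L^p(\frac{\sigma+\omega}2)}$ are the norms of $x\mapsto D_xF(\omega)$, $x\mapsto D^+_xF(\omega)$ in $L^p(X,\frac{\sigma+\omega}2)$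 (essential supremum with respect to $\sigma+\omega$ if $p=\infty$). $k_p^+=\inf_{F}\dfrac{E[|D^+F|_{L^p(\frac{\sigma+\omega}2)}]}{E[(F-m(F))^+]}$, the infimum being over non-constant random variables $F$. When $k_p^+=0$ the right-hand sides are read as $+\infty$ (unless $DF$ vanishes). A Young function is a convex, even, non-negative $N:\mathbb R\to\mathbb R$ with $N(0)=0$ and $N(x)>0$ for $x\ne0$; $N'$ is its derivative. The Orlicz norm is $\|F\|_N=\inf\{\lambda>0:E[N(F/\lambda)]\le1\}$. *)

theory Defs
  imports "HOL-Probability.Probability"
begin

section \<open>Configurations\<close>

text \<open>A configuration $\sum_i \delta_{x_i}$ with pairwise distinct $x_i$ is represented by the
  countable set of its points; \<open>config_measure\<close> recovers the measure.\<close>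

type_synonym 'a config = "'a set"

definition config_measure :: "'a::metric_space config \<Rightarrow> 'a measure" where
  "config_measure \<omega> = distr (count_space \<omega>) borel (\<lambda>x. x)"

definition radon_measure :: "'a::metric_space measure \<Rightarrow> bool" where
  "radon_measure M \<longleftrightarrow>
     sets M = sets borel \<and>
     (\<forall>K. compact K \<longrightarrow> emeasure M K < \<infinity>) \<and>
     (\<forall>B\<in>sets borel. emeasure M B = (SUP K\<in>{K. compact K \<and> K \<subseteq> B}. emeasure M K))"

definition configs :: "'a::metric_space config set" where
  "configs = {\<omega>. countable \<omega> \<and> radon_measure (config_measure \<omega>)}"

definition config_space :: "'a::metric_space config measure" where
  "config_space = sigma configs
     {{\<omega>\<in>configs. emeasure (config_measure \<omega>) B \<in> C} | B C.
        B \<in> sets borel \<and> C \<in> sets (borel :: ennreal measure)}"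

definition diffuse :: "'a measure \<Rightarrow> bool" where
  "diffuse M \<longleftrightarrow> (\<forall>x\<in>space M. emeasure M {x} = 0)"

text \<open>The two conditions on the counts determine \<open>\<pi>\<close> uniquely. The law is written out rather than
  taken from \<open>poisson_pmf\<close> because sets with \<open>\<sigma> B = 0\<close> are allowed.\<close>

definition poisson_measure :: "'a::metric_space measure \<Rightarrow> 'a config measure \<Rightarrow> bool" where
  "poisson_measure \<sigma> \<pi> \<longleftrightarrow>
     prob_space \<pi> \<and> space \<pi> = configs \<and> sets \<pi> = sets config_space \<and>
     (\<forall>B\<in>sets borel. \<forall>n::nat.
        measure \<pi> {\<omega>\<in>configs. emeasure (config_measure \<omega>) B = of_nat n} =
          exp (- measure \<sigma> B) * measure \<sigma> B ^ n / fact n) \<and>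
     (\<forall>(n::nat) B. (\<forall>i<n. B i \<in> sets borel) \<longrightarrow> disjoint_family_on B {..<n} \<longrightarrow>
        prob_space.indep_vars \<pi> (\<lambda>_. borel :: ennreal measure)
          (\<lambda>i \<omega>. emeasure (config_measure \<omega>) (B i)) {..<n})"

section \<open>Finite difference gradient and its norms\<close>

definition D :: "('a config \<Rightarrow> real) \<Rightarrow> 'a \<Rightarrow> 'a config \<Rightarrow> real" where
  "D F x \<omega> = (if x \<in> \<omega> then F \<omega> - F (\<omega> - {x}) else F \<omega> - F (insert x \<omega>))"

definition D_plus :: "('a config \<Rightarrow> real) \<Rightarrow> 'a \<Rightarrow> 'a config \<Rightarrow> real" where
  "D_plus F x \<omega> = max 0 (D F x \<omega>)"

text \<open>The measure $(\sigma + \omega)/2$. It has the same null sets as $\sigma + \omega$, so it can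
  also be used for the essential supremum.\<close>

definition half_sum :: "'a::metric_space measure \<Rightarrow> 'a config \<Rightarrow> 'a measure" where
  "half_sum \<sigma> \<omega> =
     measure_of UNIV (sets borel) (\<lambda>B. (emeasure \<sigma> B + emeasure (config_measure \<omega>) B) / 2)"

definition Lp_norm :: "ennreal \<Rightarrow> 'a measure \<Rightarrow> ('a \<Rightarrow> real) \<Rightarrow> ennreal" where
  "Lp_norm p M f =
     (if p = \<infinity> then esssup M (\<lambda>x. ennreal \<bar>f x\<bar>)
      else let I = (\<integral>\<^sup>+x. ennreal (\<bar>f x\<bar> powr enn2real p) \<partial>M)
           in if I = \<infinity> then \<infinity> else ennreal (enn2real I powr (1 / enn2real p)))"

definition grad_norm ::
    "ennreal \<Rightarrow> 'a::metric_space measure \<Rightarrow> ('a config \<Rightarrow> real) \<Rightarrow> 'a config \<Rightarrow> ennreal" where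
  "grad_norm p \<sigma> F \<omega> = Lp_norm p (half_sum \<sigma> \<omega>) (\<lambda>x. D F x \<omega>)"

definition grad_plus_norm ::
    "ennreal \<Rightarrow> 'a::metric_space measure \<Rightarrow> ('a config \<Rightarrow> real) \<Rightarrow> 'a config \<Rightarrow> ennreal" where
  "grad_plus_norm p \<sigma> F \<omega> = Lp_norm p (half_sum \<sigma> \<omega>) (\<lambda>x. D_plus F x \<omega>)"

section \<open>Medians and the constant \<open>k\<^sub>p\<^sup>+\<close>\<close>

definition is_median :: "'b measure \<Rightarrow> ('b \<Rightarrow> real) \<Rightarrow> real \<Rightarrow> bool" where
  "is_median P F m \<longleftrightarrow>
     measure P {\<omega>\<in>space P. F \<omega> \<le> m} \<ge> 1 / 2 \<and> measure P {\<omega>\<in>space P. F \<omega> \<ge> m} \<ge> 1 / 2"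

text \<open>Random variables are identified when almost surely equal, so non-constant means not almost
  surely constant. Random variables with $E[(F-m)^+] = \infty$ have no meaningful quotient and are left
  out: in \<open>ennreal\<close> their quotient would evaluate to $0$ and make the infimum vanish. If
  $E[(F-m)^+] = 0 < E[|D^+F|]$ the quotient is $\infty$. Medians need not be unique; every median of
  $F$ enters the infimum. When \<open>k_plus\<close> is $0$, a bound of the form \<open>c / k_plus p \<sigma> \<pi> * y\<close> with
  \<open>c > 0\<close> is $\infty$ unless \<open>y = 0\<close>, by the arithmetic of \<open>ennreal\<close>.\<close>

definition k_plus :: "ennreal \<Rightarrow> 'a::metric_space measure \<Rightarrow> 'a config measure \<Rightarrow> ennreal" where
  "k_plus p \<sigma> \<pi> = Inf
     {(\<integral>\<^sup>+\<omega>. grad_plus_norm p \<sigma> F \<omega> \<partial>\<pi>) / (\<integral>\<^sup>+\<omega>. ennreal (max 0 (F \<omega> - m)) \<partial>\<pi>) | F m.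
        F \<in> borel_measurable \<pi> \<and> \<not> (\<exists>c. AE \<omega> in \<pi>. F \<omega> = c) \<and> is_median \<pi> F m \<and>
        (\<integral>\<^sup>+\<omega>. ennreal (max 0 (F \<omega> - m)) \<partial>\<pi>) < \<infinity>}"

section \<open>Young functions and Orlicz norms\<close>

definition young_function :: "(real \<Rightarrow> real) \<Rightarrow> bool" where
  "young_function N \<longleftrightarrow>
     convex_on UNIV N \<and> (\<forall>x. N (- x) = N x) \<and> (\<forall>x. N x \<ge> 0) \<and> N 0 = 0 \<and> (\<forall>x. x \<noteq> 0 \<longrightarrow> N x > 0)"

text \<open>A convex function on the reals has a right derivative everywhere, which is its derivative
  wherever it is differentiable; so no differentiability of $N$ has to be assumed.\<close>

definition right_deriv :: "(real \<Rightarrow> real) \<Rightarrow> real \<Rightarrow> real" where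
  "right_deriv N x = (THE d. (N has_real_derivative d) (at_right x))"

definition young_const :: "(real \<Rightarrow> real) \<Rightarrow> ennreal" where
  "young_const N = (SUP x\<in>{0<..}. ennreal (x * right_deriv N x / N x))"

text \<open>A Young function extended by $N(\pm\infty) = \infty$, its limit at infinity; needed because
  gradient norms may be infinite.\<close>

definition young_ext :: "(real \<Rightarrow> real) \<Rightarrow> ereal \<Rightarrow> ennreal" where
  "young_ext N y = (if \<bar>y\<bar> = \<infinity> then \<infinity> else ennreal (N (real_of_ereal y)))"

definition orlicz_norm :: "(real \<Rightarrow> real) \<Rightarrow> 'b measure \<Rightarrow> ('b \<Rightarrow> ereal) \<Rightarrow> ennreal" where
  "orlicz_norm N P G =
     Inf {ennreal l | l. l > 0 \<and> (\<integral>\<^sup>+\<omega>. young_ext N (G \<omega> / ereal l) \<partial>P) \<le> 1}"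

end

theory Submission
  imports Defs
begin

text \<open>
  Suppose first that \<open>F\<close> is bounded and $0 < k_p^+ < \infty$. Testing the definition of $k_p^+$ with
  $N(F^+)$ and $N(F^-)$, whose positive gradients are supported on $F > 0$ and $F < 0$ and dominated
  there by $N'(|F|)\,|DF|$, gives $k_p^+ E[N(F)] \le E[N'(|F|)\,|DF|\,1_{\{F \ne 0\}}]$. Convexity in
  the form $N'(x) y \le N(y) + x N'(x) - N(x) \le N(y) + (C_N - 1) N(x)$ with
  $y = C_N |DF| / k_p^+$ then lets $(C_N - 1) E[N(F)]$ be absorbed. Truncation removes the
  boundedness of \<open>F\<close>, and applying the result to multiples of \<open>F\<close> yields the Orlicz norm bound.

  The degenerate values of $k_p^+$ need separate arguments. If $\sigma \ne 0$ then
  $k_p^+ < \infty$, and if $\sigma = 0$ then \<open>F\<close> vanishes almost surely. If $k_p^+ = 0$, the right-hand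
  sides are infinite unless $|DF|$ is negligible; in that case the Mecke formula shows that almost
  surely deleting points one after another never changes \<open>F\<close>, so \<open>F\<close> is almost surely constant.
\<close>

text \<open>D^+ is one-sided, and this is what lets convexity act on finite differences: any
  decrease of N(F^+) away from \<omega> is at most the slope of N at the upper end F(\<omega>) times
  |DF|, so N' is only ever evaluated at F(\<omega>), never at the neighbouring configuration.
  Absorption subtracts (C_N - 1) E[N(F)], and \<open>k_plus\<close> tests only variables with a
  finite denominator; both ask for a bounded F first. Since additivity of the integral is stated for
  measurable summands, the absorbed term is subtracted pointwise from a measurable minorant before
  integrating. In the degenerate case deletions suffice: each point x of \<omega> has mass at least
  1/2 under (\<sigma> + \<omega>)/2, so for every p the gradient norm controls F(\<omega>) -
  F(\<omega> - x). The Mecke formula is derived from the Poisson counts. Under a colouring of X with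
  finitely many colours the colour counts of \<omega> are independent Poisson variables, and for one
  colour of mass s the formula is the recursion (k + 1) P(k + 1) = s P(k).\<close>

section \<open>Lower integrals, convexity and $L^p$ norms\<close>

text \<open>The integral of a non-measurable function is its lower integral. As it is attained by a
  measurable minorant, no measurability of gradient norms in the configuration is ever needed.\<close>

lemma nn_integral_minorant:
  obtains g where "g \<in> borel_measurable M" "\<And>x. g x \<le> f x"
    "(\<integral>\<^sup>+x. g x \<partial>M) = (\<integral>\<^sup>+x. f x \<partial>M)"
proof -
  let ?S = "{g. simple_function M g \<and> g \<le> f}"
  have zero: "(\<lambda>_. 0) \<in> ?S"
    by (auto simp: le_fun_def)
  obtain h :: "nat \<Rightarrow> 'a \<Rightarrow> ennreal" where h: "range h \<subseteq> ?S"
    and eq: "(SUP g\<in>?S. integral\<^sup>S M g) = (SUP n. integral\<^sup>S M (h n))"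
  proof -
    obtain f' :: "nat \<Rightarrow> ennreal" where "range f' \<subseteq> integral\<^sup>S M ` ?S" "Sup (integral\<^sup>S M ` ?S) = (SUP n. f' n)"
      using ennreal_SUP_countable_SUP[of ?S "integral\<^sup>S M"] zero by blast
    moreover from this(1) have "\<forall>n. \<exists>g\<in>?S. f' n = integral\<^sup>S M g" by (auto simp only: image_iff subset_iff)
    then obtain h where "\<forall>n. h n \<in> ?S \<and> f' n = integral\<^sup>S M (h n)" by metis
    ultimately show thesis by (intro that[of h]) auto
  qed
  have hn: "simple_function M (h n)" "h n \<le> f" for n
    using h by auto
  \<comment> \<open>The simple functions of a maximising sequence all lie below \<open>f\<close>. So
    does their pointwise supremum, whose integral is at least each of theirs.\<close>
  let ?g = "\<lambda>x. SUP n. h n x"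
  show thesis
  proof
    show m: "?g \<in> borel_measurable M"
      using hn(1) by (intro borel_measurable_SUP) (auto intro: borel_measurable_simple_function)
    show le: "?g x \<le> f x" for x
      using hn(2) by (auto intro!: SUP_least simp: le_fun_def)
    show "integral\<^sup>N M ?g = integral\<^sup>N M f"
    proof (rule antisym)
      show "integral\<^sup>N M ?g \<le> integral\<^sup>N M f"
        using le by (intro nn_integral_mono)
      have "integral\<^sup>S M (h n) \<le> integral\<^sup>N M ?g" for n
        unfolding nn_integral_eq_simple_integral[OF hn(1), symmetric]
        by (intro nn_integral_mono SUP_upper) auto
      then show "integral\<^sup>N M f \<le> integral\<^sup>N M ?g"
        unfolding nn_integral_def[of M f] eq by (rule SUP_least)
    qed
  qed
qed

text \<open>The difference quotients from x are nondecreasing in t > x, so their infimum is both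
  their limit and a subgradient, valid for y on either side of x. This also shows that the
  \<open>THE\<close> in \<open>right_deriv\<close> is well defined.\<close>

lemma convex_right_deriv_subgradient:
  assumes "convex_on UNIV N"
  shows "N x + right_deriv N x * (y - x) \<le> N y"
proof -
  let ?q = "\<lambda>t. (N x - N t) / (x - t)"
  define d where "d = Inf (?q ` ({x<..} \<inter> UNIV))"
  have ge: "N y \<ge> N x + d * (y - x)" for y
    unfolding d_def using assms by (intro convex_le_Inf_differential) auto
  have "(?q \<longlongrightarrow> d) (at x within ({x<..} \<inter> UNIV))"
    unfolding d_def
  proof (rule Lim_right_bound)
    show "?q a \<le> ?q b" if "x < a" "a \<le> b" for a b
      using convex_on_slope_le(1)[OF assms, of x b a] that by (cases "a = b") auto
    show "d \<le> ?q a" if "x < a" for a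
      using ge[of a] that by (simp add: field_simps)
  qed
  moreover have "?q = (\<lambda>t. (N t - N x) / (t - x))"
    by (auto simp: fun_eq_iff) (metis minus_diff_eq minus_divide_divide)
  ultimately have "(N has_real_derivative d) (at_right x)"
    by (simp add: has_field_derivative_iff)
  then have "right_deriv N x = d"
    unfolding right_deriv_def
    by (intro the_equality) (auto simp: has_field_derivative_iff intro: tendsto_unique[rotated])
  then show ?thesis using ge by simp
qed

lemma Lp_norm_le:
  assumes [measurable]: "f \<in> borel_measurable M" "g \<in> borel_measurable M"
    and p: "1 \<le> p" and a: "0 \<le> a" and le: "\<And>x. \<bar>g x\<bar> \<le> a * \<bar>f x\<bar>"
  shows "Lp_norm p M g \<le> ennreal a * Lp_norm p M f"
proof (cases "p = \<infinity>")
  case True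
  have "AE x in M. ennreal \<bar>g x\<bar> \<le> ennreal a * esssup M (\<lambda>x. ennreal \<bar>f x\<bar>)"
    using esssup_AE[where M=M and f="\<lambda>x. ennreal \<bar>f x\<bar>"]
  proof eventually_elim
    case (elim x)
    have "ennreal \<bar>g x\<bar> \<le> ennreal (a * \<bar>f x\<bar>)"
      using le by (intro ennreal_leI)
    also have "\<dots> = ennreal a * ennreal \<bar>f x\<bar>"
      using a by (simp add: ennreal_mult)
    finally show ?case
      using mult_left_mono[OF elim, of "ennreal a"] by auto
  qed
  then show ?thesis
    using True by (auto simp: Lp_norm_def intro!: esssup_I)
next
  case False
  define r where "r = enn2real p"
  have r: "1 \<le> r"
    using False p unfolding r_def by (cases p) (auto simp flip: ennreal_1 simp: ennreal_le_iff)
  define I where "I = (\<lambda>f::'a\<Rightarrow>real. \<integral>\<^sup>+x. ennreal (\<bar>f x\<bar> powr r) \<partial>M)"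
  have Lp: "Lp_norm p M f = (if I f = \<infinity> then \<infinity> else ennreal (enn2real (I f) powr (1 / r)))" for f
    using False by (simp add: Lp_norm_def I_def r_def Let_def)
  have "I g \<le> (\<integral>\<^sup>+x. ennreal (a powr r) * ennreal (\<bar>f x\<bar> powr r) \<partial>M)"
    unfolding I_def using le r a
    by (intro nn_integral_mono) (simp add: ennreal_mult[symmetric] powr_mult[symmetric] powr_mono2)
  also have "\<dots> = ennreal (a powr r) * I f"
    unfolding I_def by (rule nn_integral_cmult) simp
  finally have Ile: "I g \<le> ennreal (a powr r) * I f" .
  show ?thesis
  proof (cases "I f = \<infinity>")
    case True
    show ?thesis
    proof (cases "a = 0")
      \<comment> \<open>With a = 0 the right-hand side is 0 * top = 0, so an infinite norm of
        \<open>f\<close> does not make the claim trivial.\<close>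
      case True
      then have "I g = 0" using Ile r by simp
      then show ?thesis using r by (simp add: Lp)
    qed (use a True in \<open>simp add: Lp ennreal_mult_top\<close>)
  next
    case False
    then have fin: "ennreal (a powr r) * I f < \<infinity>"
      by (simp add: ennreal_mult_less_top less_top)
    then have "I g \<noteq> \<infinity>" using Ile by (auto simp: top_unique)
    moreover have "enn2real (I g) \<le> a powr r * enn2real (I f)"
      using enn2real_mono[OF Ile] fin by (simp add: enn2real_mult)
    then have "enn2real (I g) powr (1 / r) \<le> (a powr r * enn2real (I f)) powr (1 / r)"
      using r by (intro powr_mono2) auto
    moreover have "\<dots> = a * enn2real (I f) powr (1 / r)"
      using a r by (simp add: powr_mult powr_powr)
    ultimately show ?thesis
      using False a by (simp add: Lp ennreal_mult[symmetric] ennreal_leI)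
  qed
qed

text \<open>An atom of mass at least c contributes at least c |f x|^r to the r-th power of the norm,
  and c^r <= c because c <= 1. With the factor c instead of c^(1/r) the bound is the same for all p,
  including infinity.\<close>

lemma Lp_norm_ge_atom:
  assumes p: "1 \<le> p" and x: "{x} \<in> sets M" and c: "0 < c" "c \<le> 1" "ennreal c \<le> emeasure M {x}"
  shows "ennreal (c * \<bar>f x\<bar>) \<le> Lp_norm p M f"
proof (cases "p = \<infinity>")
  case True
  have "ennreal \<bar>f x\<bar> \<le> esssup M (\<lambda>x. ennreal \<bar>f x\<bar>)"
  proof -
    have "AE y in M. ennreal \<bar>f y\<bar> \<le> esssup M (\<lambda>x. ennreal \<bar>f x\<bar>)"
      by (rule esssup_AE)
    then obtain Z where Z: "Z \<in> null_sets M"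
      "{y\<in>space M. \<not> ennreal \<bar>f y\<bar> \<le> esssup M (\<lambda>x. ennreal \<bar>f x\<bar>)} \<subseteq> Z"
      by (auto simp: eventually_ae_filter)
    have "x \<notin> Z"
    proof
      assume "x \<in> Z"
      then have "emeasure M {x} \<le> emeasure M Z"
        using Z by (intro emeasure_mono) auto
      with c Z(1) show False by (auto simp: null_sets_def)
    qed
    then show ?thesis using Z(2) sets.sets_into_space[OF x] by auto
  qed
  moreover have "ennreal (c * \<bar>f x\<bar>) \<le> ennreal \<bar>f x\<bar>"
    using c mult_right_mono[of c 1 "\<bar>f x\<bar>"] by (intro ennreal_leI) auto
  ultimately have "ennreal (c * \<bar>f x\<bar>) \<le> esssup M (\<lambda>x. ennreal \<bar>f x\<bar>)"
    by (rule order_trans[rotated])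
  then show ?thesis
    using True by (simp add: Lp_norm_def)
next
  case False
  define r where "r = enn2real p"
  have r: "1 \<le> r"
    using False p unfolding r_def by (cases p) (auto simp flip: ennreal_1 simp: ennreal_le_iff)
  define I where "I = (\<integral>\<^sup>+x. ennreal (\<bar>f x\<bar> powr r) \<partial>M)"
  have "ennreal (c * \<bar>f x\<bar> powr r) \<le> ennreal (\<bar>f x\<bar> powr r) * emeasure M {x}"
    using c mult_left_mono[OF c(3), of "ennreal (\<bar>f x\<bar> powr r)"] by (simp add: ennreal_mult mult.commute)
  also have "\<dots> = (\<integral>\<^sup>+y. ennreal (\<bar>f x\<bar> powr r) * indicator {x} y \<partial>M)"
    using x by (simp add: nn_integral_cmult_indicator)
  also have "\<dots> \<le> I"
    unfolding I_def by (intro nn_integral_mono) (auto split: split_indicator)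
  finally have le: "ennreal (c * \<bar>f x\<bar> powr r) \<le> I" .
  show ?thesis
  proof (cases "I = \<infinity>")
    case True
    then show ?thesis using False by (simp add: Lp_norm_def I_def r_def)
  next
    case fin: False
    have "(c * \<bar>f x\<bar>) powr r \<le> c * \<bar>f x\<bar> powr r"
      using c r powr_mono'[of 1 r c] by (simp add: powr_mult mult_right_mono)
    also have "\<dots> \<le> enn2real I"
      using le fin c by (metis ennreal_enn2real_if ennreal_le_iff enn2real_nonneg infinity_ennreal_def)
    finally have "((c * \<bar>f x\<bar>) powr r) powr (1 / r) \<le> enn2real I powr (1 / r)"
      using r by (intro powr_mono2) auto
    then have "c * \<bar>f x\<bar> \<le> enn2real I powr (1 / r)"
      using r c by (simp add: powr_powr)
    then show ?thesis
      using False fin by (simp add: Lp_norm_def I_def[symmetric] r_def[symmetric] Let_def ennreal_leI)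
  qed
qed

lemma Lp_norm_zero [simp]: "1 \<le> p \<Longrightarrow> Lp_norm p M (\<lambda>x. 0) = 0"
  using Lp_norm_le[of "\<lambda>x. 0" M "\<lambda>x. 0" p 0] by simp

text \<open>The summand 1 raises the base to at least 1: then (1 + a)^(1/r) <= 1 + a for every r >=
  1, a bound free of p that also covers the essential supremum.\<close>

lemma Lp_norm_le_mass:
  assumes [measurable]: "f \<in> borel_measurable M"
    and p: "1 \<le> p" and le: "\<And>x. \<bar>f x\<bar> \<le> 1" and a: "0 \<le> a" "emeasure M (space M) \<le> ennreal a"
  shows "Lp_norm p M f \<le> ennreal (1 + a)"
proof (cases "p = \<infinity>")
  case True
  have "esssup M (\<lambda>x. ennreal \<bar>f x\<bar>) \<le> ennreal (1 + a)"
    using le a(1) by (intro esssup_I AE_I2 ennreal_leI) (auto intro: order_trans[of _ 1])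
  then show ?thesis using True by (simp add: Lp_norm_def)
next
  case False
  define r where "r = enn2real p"
  have r: "1 \<le> r"
    using False p unfolding r_def by (cases p) (auto simp flip: ennreal_1 simp: ennreal_le_iff)
  define I where "I = (\<integral>\<^sup>+x. ennreal (\<bar>f x\<bar> powr r) \<partial>M)"
  have "I \<le> (\<integral>\<^sup>+x. 1 \<partial>M)"
    unfolding I_def using le r by (intro nn_integral_mono) (auto intro: powr_le1)
  also have "\<dots> \<le> ennreal a" using a by simp
  finally have I: "I \<le> ennreal a" .
  have i: "enn2real I \<le> a"
    using enn2real_mono[OF I] a by simp
  have "enn2real I powr (1 / r) \<le> (1 + a) powr (1 / r)"
    using i r by (intro powr_mono2) auto
  also have "\<dots> \<le> (1 + a) powr 1"
    using a r by (intro powr_mono) auto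
  finally have "enn2real I powr (1 / r) \<le> 1 + a" using a by simp
  moreover have "I \<noteq> \<infinity>"
    using I by (auto simp: top_unique)
  ultimately show ?thesis
    using False by (auto simp: Lp_norm_def I_def[symmetric] r_def[symmetric] Let_def ennreal_leI)
qed

section \<open>The Mecke formula\<close>

text \<open>The sum inside the Mecke formula. As a value of a counting measure it is countably
  additive in \<open>A\<close>; infinite configurations, a null event, are given the value
  0.\<close>

definition del_count :: "'a config set \<Rightarrow> 'a config \<Rightarrow> ennreal" where
  "del_count A \<omega> = (if finite \<omega> then emeasure (count_space \<omega>) {x\<in>\<omega>. \<omega> - {x} \<in> A} else 0)"

text \<open>A multiset records all colour counts at once, takes countably many values, and passes to
  coarser colourings by \<open>image_mset\<close>. For infinite \<omega> it is empty, because
  \<open>mset_set\<close> is; hence the explicit \<open>finite \<omega>\<close> in the events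
  below.\<close>

definition colours :: "('a \<Rightarrow> nat) \<Rightarrow> 'a config \<Rightarrow> nat multiset" where
  "colours c \<omega> = image_mset c (mset_set \<omega>)"

lemma count_colours: "finite \<omega> \<Longrightarrow> count (colours c \<omega>) i = card {x\<in>\<omega>. c x = i}"
proof -
  assume fin: "finite \<omega>"
  have "count (colours c \<omega>) i = (\<Sum>x\<in>c -` {i} \<inter> \<omega>. count (mset_set \<omega>) x)"
    using fin by (simp add: colours_def count_image_mset)
  also have "\<dots> = card (c -` {i} \<inter> \<omega>)"
    using fin by (simp add: count_mset_set)
  also have "c -` {i} \<inter> \<omega> = {x\<in>\<omega>. c x = i}" by auto
  finally show ?thesis .
qed

lemma colours_remove:
  "finite \<omega> \<Longrightarrow> x \<in> \<omega> \<Longrightarrow> colours c \<omega> = add_mset (c x) (colours c (\<omega> - {x}))"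
  by (simp add: colours_def mset_set.remove)

lemma emeasure_config_measure:
  assumes "B \<in> sets borel"
  shows "emeasure (config_measure \<omega>) B = (if finite (\<omega> \<inter> B) then of_nat (card (\<omega> \<inter> B)) else \<infinity>)"
proof -
  have "emeasure (config_measure \<omega>) B = emeasure (count_space \<omega>) (\<omega> \<inter> B)"
    unfolding config_measure_def using assms
    by (subst emeasure_distr) (auto simp: vimage_def Int_commute)
  then show ?thesis by (simp add: emeasure_count_space)
qed

lemma finite_in_configs:
  assumes "finite \<omega>"
  shows "\<omega> \<in> configs"
proof -
  have "emeasure (config_measure \<omega>) B = (SUP K\<in>{K. compact K \<and> K \<subseteq> B}. emeasure (config_measure \<omega>) K)"
    if B: "B \<in> sets borel" for B
  proof (rule antisym)
    have "emeasure (config_measure \<omega>) B = emeasure (config_measure \<omega>) (\<omega> \<inter> B)"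
      using assms B by (subst (1 2) emeasure_config_measure)
        (auto intro: borel_closed finite_imp_closed)
    then show "emeasure (config_measure \<omega>) B \<le> (SUP K\<in>{K. compact K \<and> K \<subseteq> B}. emeasure (config_measure \<omega>) K)"
      using assms by (auto intro!: SUP_upper2[of "\<omega> \<inter> B"] finite_imp_compact)
    show "(SUP K\<in>{K. compact K \<and> K \<subseteq> B}. emeasure (config_measure \<omega>) K) \<le> emeasure (config_measure \<omega>) B"
      using B by (intro SUP_least emeasure_mono) (auto simp: config_measure_def)
  qed
  moreover have "sets (config_measure \<omega>) = sets borel"
    by (simp add: config_measure_def)
  moreover have "emeasure (config_measure \<omega>) K < \<infinity>" if "compact K" for K
    using assms that by (simp add: emeasure_config_measure borel_compact of_nat_less_top)
  ultimately have "radon_measure (config_measure \<omega>)"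
    unfolding radon_measure_def by blast
  then show ?thesis
    using assms by (simp add: configs_def countable_finite)
qed

locale poisson_process =
  fixes \<sigma> :: "'a::metric_space measure" and \<pi> :: "'a config measure"
  assumes sets_\<sigma> [measurable_cong]: "sets \<sigma> = sets borel"
    and finite_\<sigma>: "finite_measure \<sigma>"
    and poisson: "poisson_measure \<sigma> \<pi>"
begin

sublocale \<sigma>: finite_measure \<sigma>
  by (rule finite_\<sigma>)

sublocale prob_space \<pi>
  using poisson by (simp add: poisson_measure_def)

lemma space_\<sigma> [simp]: "space \<sigma> = UNIV"
  using sets_eq_imp_space_eq[OF sets_\<sigma>] by simp

lemma space_\<pi> [simp]: "space \<pi> = configs"
  using poisson by (simp add: poisson_measure_def)

lemma sets_\<pi>:
  "sets \<pi> = sigma_sets configs {{\<omega>\<in>configs. emeasure (config_measure \<omega>) B \<in> C} | B C.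
     B \<in> sets borel \<and> C \<in> sets (borel :: ennreal measure)}"
proof -
  have "sets \<pi> = sets config_space"
    using poisson by (simp add: poisson_measure_def)
  then show ?thesis
    unfolding config_space_def by (subst (asm) sets_measure_of) auto
qed

lemma measurable_config_measure [measurable]:
  assumes "B \<in> sets borel"
  shows "(\<lambda>\<omega>. emeasure (config_measure \<omega>) B) \<in> borel_measurable \<pi>"
proof (rule measurableI)
  fix C :: "ennreal set" assume "C \<in> sets borel"
  moreover have "(\<lambda>\<omega>. emeasure (config_measure \<omega>) B) -` C \<inter> space \<pi> =
      {\<omega>\<in>configs. emeasure (config_measure \<omega>) B \<in> C}" by auto
  ultimately show "(\<lambda>\<omega>. emeasure (config_measure \<omega>) B) -` C \<inter> space \<pi> \<in> sets \<pi>"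
    unfolding sets_\<pi> using assms by (auto intro!: sigma_sets.Basic)
qed simp

lemma sets_count:
  assumes "B \<in> sets borel"
  shows "{\<omega>\<in>configs. emeasure (config_measure \<omega>) B = of_nat n} \<in> sets \<pi>"
  using measurable_sets[OF measurable_config_measure[OF assms], of "{of_nat n}"]
  by (simp add: vimage_def Int_def conj_commute)

lemma prob_count:
  "B \<in> sets borel \<Longrightarrow> prob {\<omega>\<in>configs. emeasure (config_measure \<omega>) B = of_nat n} =
     exp (- measure \<sigma> B) * measure \<sigma> B ^ n / fact n"
  using poisson by (simp add: poisson_measure_def)

lemma finite_iff_count: "finite \<omega> \<longleftrightarrow> (\<exists>n. emeasure (config_measure \<omega>) UNIV = of_nat n)"
  by (auto simp: emeasure_config_measure)

text \<open>The Poisson weights of the finite values of \<omega>(X) already add up to exp(-s) exp(s)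
  = 1, which leaves no mass for an infinite count.\<close>

lemma AE_finite: "AE \<omega> in \<pi>. finite \<omega>"
proof -
  let ?E = "\<lambda>n::nat. {\<omega>\<in>configs. emeasure (config_measure \<omega>) UNIV = of_nat n}"
  let ?s = "measure \<sigma> UNIV"
  have E: "?E n \<in> sets \<pi>" for n
    by (rule sets_count) simp
  have "(\<lambda>n. prob (?E n)) sums prob (\<Union>n. ?E n)"
    using E by (intro finite_measure_UNION) (auto simp: disjoint_family_on_def)
  moreover have "(\<lambda>n. prob (?E n)) sums (exp (- ?s) * exp ?s)"
  proof -
    have "(\<lambda>n. ?s ^ n / fact n) sums exp ?s"
      using exp_converges[of ?s] by (simp add: divide_inverse mult.commute)
    from sums_mult[OF this, of "exp (- ?s)"] show ?thesis
      by (simp add: prob_count)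
  qed
  ultimately have "prob (\<Union>n. ?E n) = exp (- ?s) * exp ?s"
    by (rule sums_unique2)
  then have "prob (\<Union>n. ?E n) = 1"
    by (simp add: exp_minus)
  then have "AE \<omega> in \<pi>. \<omega> \<in> (\<Union>n. ?E n)"
    using E by (subst AE_in_set_eq_1) auto
  then show ?thesis
    by eventually_elim (auto simp: finite_iff_count)
qed

lemma sets_finite: "{\<omega>. finite \<omega>} \<in> sets \<pi>"
proof -
  have "{\<omega>. finite \<omega>} = (\<Union>n. (\<lambda>\<omega>. emeasure (config_measure \<omega>) UNIV) -` {of_nat n} \<inter> space \<pi>)"
    using finite_in_configs by (auto simp: finite_iff_count)
  also have "\<dots> \<in> sets \<pi>"
    using measurable_sets[OF measurable_config_measure[of UNIV]]
    by (intro sets.countable_UN image_subsetI) simp_all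
  finally show ?thesis .
qed

section \<open>Colour counts under a colouring with finitely many colours\<close>

context
  fixes c :: "'a \<Rightarrow> nat" and n :: nat
  assumes c: "c \<in> borel \<rightarrow>\<^sub>M count_space UNIV" and n: "range c \<subseteq> {..<n}"
begin

lemma sets_colour [measurable]: "c -` {i} \<in> sets borel"
  using measurable_sets[OF c, of "{i}"] by simp

text \<open>A finite intersection of count events is the form to which measurability of counts and
  the independence clause of \<open>poisson_measure\<close> apply.\<close>

lemma colours_eq_Inter:
  assumes \<mu>: "set_mset \<mu> \<subseteq> {..<n}"
  shows "{\<omega>. finite \<omega> \<and> colours c \<omega> = \<mu>} =
    (\<Inter>i\<in>{..<n}. (\<lambda>\<omega>. emeasure (config_measure \<omega>) (c -` {i})) -` {of_nat (count \<mu> i)} \<inter> space \<pi>)"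
    (is "?L = ?R")
proof (intro set_eqI iffI)
  fix \<omega> assume "\<omega> \<in> ?L"
  then have fin: "finite \<omega>" and eq: "colours c \<omega> = \<mu>" by auto
  have "\<omega> \<inter> c -` {i} = {x\<in>\<omega>. c x = i}" for i by auto
  then show "\<omega> \<in> ?R"
    using fin finite_in_configs[OF fin] count_colours[OF fin, of c]
    by (simp add: emeasure_config_measure sets_colour eq)
next
  fix \<omega> assume R: "\<omega> \<in> ?R"
  have "finite (\<omega> \<inter> c -` {i}) \<and> card (\<omega> \<inter> c -` {i}) = count \<mu> i" if "i < n" for i
    using R that by (auto simp: emeasure_config_measure sets_colour split: if_splits)
  note * = this
  have "\<omega> = (\<Union>i\<in>{..<n}. \<omega> \<inter> c -` {i})" using n by auto
  also have "finite \<dots>" using * by blast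
  finally have fin: "finite \<omega>" .
  have "count (colours c \<omega>) i = count \<mu> i" for i
  proof (cases "i < n")
    case True
    have "\<omega> \<inter> c -` {i} = {x\<in>\<omega>. c x = i}" by auto
    then show ?thesis using *[OF True] by (simp add: count_colours[OF fin])
  next
    case False
    then have "card {x\<in>\<omega>. c x = i} = 0" using n by (auto simp: card_eq_0_iff)
    moreover have "i \<notin># \<mu>" using False \<mu> by auto
    ultimately show ?thesis by (simp add: count_colours[OF fin] not_in_iff)
  qed
  then show "\<omega> \<in> ?L" using fin by (auto intro: multiset_eqI)
qed

lemma set_mset_colours: "set_mset (colours c \<omega>) \<subseteq> {..<n}"
  using n by (auto simp: colours_def)

lemma colours_eq_empty:
  "\<not> set_mset \<mu> \<subseteq> {..<n} \<Longrightarrow> {\<omega>. finite \<omega> \<and> colours c \<omega> = \<mu>} = {}"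
  using set_mset_colours by blast

lemma n_pos: "{..<n} \<noteq> {}"
  using n by auto

lemma sets_colours_eq: "{\<omega>. finite \<omega> \<and> colours c \<omega> = \<mu>} \<in> sets \<pi>"
proof (cases "set_mset \<mu> \<subseteq> {..<n}")
  case True
  show ?thesis
    unfolding colours_eq_Inter[OF True] using n_pos
    by (intro sets.finite_INT measurable_sets[OF measurable_config_measure] sets_colour) auto
qed (simp add: colours_eq_empty)

lemma prob_colours_eq:
  assumes \<mu>: "set_mset \<mu> \<subseteq> {..<n}"
  shows "prob {\<omega>. finite \<omega> \<and> colours c \<omega> = \<mu>} =
    (\<Prod>i<n. exp (- measure \<sigma> (c -` {i})) * measure \<sigma> (c -` {i}) ^ count \<mu> i / fact (count \<mu> i))"
proof -
  have "(\<forall>i<n. B i \<in> sets borel) \<Longrightarrow> disjoint_family_on B {..<n} \<Longrightarrow> indep_vars (\<lambda>_. borel :: ennreal measure)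
      (\<lambda>i \<omega>. emeasure (config_measure \<omega>) (B i)) {..<n}" for B
    using poisson unfolding poisson_measure_def by blast
  from this[of "\<lambda>i. c -` {i}"] have "indep_vars (\<lambda>_. borel :: ennreal measure)
      (\<lambda>i \<omega>. emeasure (config_measure \<omega>) (c -` {i})) {..<n}"
    by (auto simp: sets_colour disjoint_family_on_def)
  from indep_varsD[OF this n_pos finite_lessThan order_refl, of "\<lambda>i. {of_nat (count \<mu> i)}"]
  have "prob {\<omega>. finite \<omega> \<and> colours c \<omega> = \<mu>} = (\<Prod>i<n. prob ((\<lambda>\<omega>. emeasure (config_measure \<omega>) (c -` {i})) -`
      {of_nat (count \<mu> i)} \<inter> space \<pi>))"
    by (simp add: colours_eq_Inter[OF \<mu>])
  moreover have "(\<lambda>\<omega>. emeasure (config_measure \<omega>) (c -` {i})) -` {of_nat (count \<mu> i)} \<inter> space \<pi> =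
      {\<omega>\<in>configs. emeasure (config_measure \<omega>) (c -` {i}) = of_nat (count \<mu> i)}" for i
    by auto
  ultimately show ?thesis
    by (simp only: prob_count sets_colour)
qed

text \<open>Adding a point of colour i changes only the factor of colour i in the product, and the
  Poisson weights satisfy (k + 1) q(k + 1) = s q(k), where s is the mass of that colour
  class.\<close>

lemma prob_colours_add:
  "real (Suc (count \<mu> i)) * prob {\<omega>. finite \<omega> \<and> colours c \<omega> = add_mset i \<mu>} =
   measure \<sigma> (c -` {i}) * prob {\<omega>. finite \<omega> \<and> colours c \<omega> = \<mu>}"
proof (cases "i < n \<and> set_mset \<mu> \<subseteq> {..<n}")
  case True
  define q where "q = (\<lambda>j k. exp (- measure \<sigma> (c -` {j})) * measure \<sigma> (c -` {j}) ^ k / fact k)"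
  have "prob {\<omega>. finite \<omega> \<and> colours c \<omega> = add_mset i \<mu>} =
      q i (Suc (count \<mu> i)) * (\<Prod>j\<in>{..<n} - {i}. q j (count \<mu> j))"
    using True by (subst prob_colours_eq) (auto simp: q_def prod.remove[of _ i])
  moreover have "prob {\<omega>. finite \<omega> \<and> colours c \<omega> = \<mu>} =
      q i (count \<mu> i) * (\<Prod>j\<in>{..<n} - {i}. q j (count \<mu> j))"
    using True by (subst prob_colours_eq) (auto simp: q_def prod.remove[of _ i])
  moreover have "real (Suc (count \<mu> i)) * q i (Suc (count \<mu> i)) = measure \<sigma> (c -` {i}) * q i (count \<mu> i)"
    by (simp add: q_def divide_simps del: of_nat_Suc)
  ultimately show ?thesis by (simp only: mult.assoc[symmetric])
next
  case False
  \<comment> \<open>Both sides vanish: either i is not a colour, so its class is empty, or \<mu>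
    contains a colour that no configuration shows.\<close>
  then have "measure \<sigma> (c -` {i}) = 0 \<or> prob {\<omega>. finite \<omega> \<and> colours c \<omega> = \<mu>} = 0"
  proof (cases "i < n")
    case False
    then have "c -` {i} = {}" using n by auto
    then show ?thesis by simp
  qed (use colours_eq_empty[of \<mu>] measure_empty in metis)
  moreover have "prob {\<omega>. finite \<omega> \<and> colours c \<omega> = add_mset i \<mu>} = 0"
    using False by (subst colours_eq_empty) auto
  ultimately show ?thesis by auto
qed

text \<open>Deleting x leaves the colours \<mu> exactly when \<omega> has the colours \<mu> plus
  that of x. If this colour is i, then x may be any of the \<open>Suc (count \<mu> i)\<close> points
  of colour i.\<close>

lemma del_count_colours_eq:
  "del_count {\<omega>. finite \<omega> \<and> colours c \<omega> = \<mu>} \<omega> =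
    (\<Sum>i<n. ennreal (Suc (count \<mu> i)) * indicator {\<omega>. finite \<omega> \<and> colours c \<omega> = add_mset i \<mu>} \<omega>)"
proof (cases "finite \<omega>")
  case True
  let ?X = "\<lambda>i. {x\<in>\<omega>. c x = i \<and> colours c (\<omega> - {x}) = \<mu>}"
  have "{x\<in>\<omega>. \<omega> - {x} \<in> {\<omega>. finite \<omega> \<and> colours c \<omega> = \<mu>}} = (\<Union>i\<in>{..<n}. ?X i)"
    using True n by auto
  then have "del_count {\<omega>. finite \<omega> \<and> colours c \<omega> = \<mu>} \<omega> = of_nat (card (\<Union>i\<in>{..<n}. ?X i))"
    using True unfolding del_count_def
    by (simp only: if_True) (subst emeasure_count_space_finite, auto)
  also have "card (\<Union>i\<in>{..<n}. ?X i) = (\<Sum>i<n. card (?X i))"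
    using True by (intro card_UN_disjoint) auto
  finally have "del_count {\<omega>. finite \<omega> \<and> colours c \<omega> = \<mu>} \<omega> = of_nat (\<Sum>i<n. card (?X i))" .
  moreover have "card (?X i) = (if colours c \<omega> = add_mset i \<mu> then Suc (count \<mu> i) else 0)" for i
  proof -
    have "?X i = {x\<in>\<omega>. c x = i \<and> colours c \<omega> = add_mset i \<mu>}"
    proof -
      have "colours c (\<omega> - {x}) = \<mu> \<longleftrightarrow> colours c \<omega> = add_mset (c x) \<mu>" if "x \<in> \<omega>" for x
        using colours_remove[OF True that, of c] by simp
      then show ?thesis by auto
    qed
    then show ?thesis
      using count_colours[OF True, of c i] by auto
  qed
  ultimately have "del_count {\<omega>. finite \<omega> \<and> colours c \<omega> = \<mu>} \<omega> =
      of_nat (\<Sum>i<n. if colours c \<omega> = add_mset i \<mu> then Suc (count \<mu> i) else 0)"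
    by (simp only:)
  also have "\<dots> = (\<Sum>i<n. ennreal (Suc (count \<mu> i)) * indicator {\<omega>. finite \<omega> \<and> colours c \<omega> = add_mset i \<mu>} \<omega>)"
    unfolding of_nat_sum using True
    by (intro sum.cong) (auto simp: ennreal_of_nat_eq_real_of_nat simp del: of_nat_Suc)
  finally show ?thesis .
qed (simp add: del_count_def)

lemma measure_\<sigma>_colours: "measure \<sigma> UNIV = (\<Sum>i<n. measure \<sigma> (c -` {i}))"
proof -
  have "UNIV = (\<Union>i\<in>{..<n}. c -` {i})" using n by auto
  then show ?thesis
    using sets_colour by (subst \<sigma>.finite_measure_finite_Union[symmetric])
      (auto simp: disjoint_family_on_def sets_\<sigma>)
qed

end

text \<open>The Mecke formula $E \sum_{x\in\omega} 1_A(\omega - x) = \sigma(X)\, \pi(A)$. Measurability of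
  the sum is part of the predicate because both are proved by the same induction over \<open>A\<close>.\<close>

definition mecke :: "'a config set \<Rightarrow> bool" where
  "mecke A \<longleftrightarrow> A \<in> sets \<pi> \<and> del_count A \<in> borel_measurable \<pi> \<and>
     (\<integral>\<^sup>+\<omega>. del_count A \<omega> \<partial>\<pi>) = emeasure \<sigma> UNIV * emeasure \<pi> A"

text \<open>Summing the one-colour identity over i turns the masses of the colour classes into the
  total mass \<sigma>(X).\<close>

lemma mecke_colours_eq:
  assumes c: "c \<in> borel \<rightarrow>\<^sub>M count_space UNIV" and n: "range c \<subseteq> {..<n}"
  shows "mecke {\<omega>. finite \<omega> \<and> colours c \<omega> = \<mu>}"
proof -
  note [measurable] = sets_colours_eq[OF c n]
  let ?E = "\<lambda>\<mu>. {\<omega>. finite \<omega> \<and> colours c \<omega> = \<mu>}"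
  have eq: "del_count (?E \<mu>) = (\<lambda>\<omega>. \<Sum>i<n. ennreal (Suc (count \<mu> i)) * indicator (?E (add_mset i \<mu>)) \<omega>)"
    by (intro ext del_count_colours_eq[OF c n])
  have "(\<integral>\<^sup>+\<omega>. del_count (?E \<mu>) \<omega> \<partial>\<pi>) = (\<Sum>i<n. ennreal (Suc (count \<mu> i)) * emeasure \<pi> (?E (add_mset i \<mu>)))"
    unfolding eq by (subst nn_integral_sum) (auto simp: nn_integral_cmult_indicator simp del: of_nat_Suc cong: sum.cong)
  also have "\<dots> = (\<Sum>i<n. ennreal (measure \<sigma> (c -` {i}) * prob (?E \<mu>)))"
    by (simp add: emeasure_eq_measure ennreal_mult[symmetric] prob_colours_add[OF c n, symmetric] del: of_nat_Suc)
  also have "(\<Sum>i<n. ennreal (measure \<sigma> (c -` {i}) * prob (?E \<mu>))) = ennreal (measure \<sigma> UNIV * prob (?E \<mu>))"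
    by (simp add: sum_ennreal sum_distrib_right[symmetric] measure_\<sigma>_colours[OF c n])
  finally have "(\<integral>\<^sup>+\<omega>. del_count (?E \<mu>) \<omega> \<partial>\<pi>) = ennreal (measure \<sigma> UNIV * prob (?E \<mu>))" .
  moreover have "del_count (?E \<mu>) \<in> borel_measurable \<pi>"
    unfolding eq by measurable
  ultimately show ?thesis
    unfolding mecke_def by (simp add: ennreal_mult emeasure_eq_measure \<sigma>.emeasure_eq_measure)
qed

lemma mecke_UN:
  assumes A: "\<And>i::nat. mecke (A i)" and disj: "disjoint_family A"
  shows "mecke (\<Union>i. A i)"
proof -
  have eq: "del_count (\<Union>i. A i) = (\<lambda>\<omega>. \<Sum>i. del_count (A i) \<omega>)"
  proof
    fix \<omega> :: "'a config"
    have "(\<Union>i. {x\<in>\<omega>. \<omega> - {x} \<in> A i}) = {x\<in>\<omega>. \<omega> - {x} \<in> (\<Union>i. A i)}" by auto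
    moreover have "(\<Sum>i. emeasure (count_space \<omega>) {x\<in>\<omega>. \<omega> - {x} \<in> A i}) =
        emeasure (count_space \<omega>) (\<Union>i. {x\<in>\<omega>. \<omega> - {x} \<in> A i})"
      using disj by (intro suminf_emeasure) (auto simp: disjoint_family_on_def)
    ultimately show "del_count (\<Union>i. A i) \<omega> = (\<Sum>i. del_count (A i) \<omega>)"
      by (cases "finite \<omega>") (simp_all only: del_count_def if_True if_False suminf_zero)
  qed
  have [measurable]: "A i \<in> sets \<pi>" "del_count (A i) \<in> borel_measurable \<pi>" for i
    using A by (auto simp: mecke_def)
  have "(\<integral>\<^sup>+\<omega>. del_count (\<Union>i. A i) \<omega> \<partial>\<pi>) = (\<Sum>i. emeasure \<sigma> UNIV * emeasure \<pi> (A i))"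
    unfolding eq using A by (simp add: nn_integral_suminf mecke_def)
  also have "\<dots> = emeasure \<sigma> UNIV * emeasure \<pi> (\<Union>i. A i)"
    using disj by (simp add: ennreal_suminf_cmult suminf_emeasure image_subset_iff)
  finally show ?thesis
    unfolding mecke_def by (simp add: eq)
qed

lemma mecke_empty: "mecke {}"
proof -
  have "del_count {} = (\<lambda>_::'a config. 0)" by (simp add: fun_eq_iff del_count_def)
  then show ?thesis unfolding mecke_def by simp
qed

lemma mecke_colours:
  assumes c: "c \<in> borel \<rightarrow>\<^sub>M count_space UNIV" and fin: "finite (range c)"
  shows "mecke {\<omega>. finite \<omega> \<and> colours c \<omega> \<in> M}"
proof -
  obtain n where n: "range c \<subseteq> {..<n}"
    using finite_nat_iff_bounded[of "range c"] fin by auto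
  \<comment> \<open>Finite multisets of naturals are numbered through their sorted lists, so that
    the event becomes a countable disjoint union of events fixing one multiset.\<close>
  let ?i = "\<lambda>\<mu>. to_nat (sorted_list_of_multiset \<mu>)"
  let ?A = "\<lambda>i. {\<omega>. finite \<omega> \<and> colours c \<omega> \<in> M \<and> ?i (colours c \<omega>) = i}"
  have inj: "?i \<mu> = ?i \<nu> \<longleftrightarrow> \<mu> = \<nu>" for \<mu> \<nu> :: "nat multiset"
    by (metis mset_sorted_list_of_multiset from_nat_to_nat)
  have "mecke (\<Union>i. ?A i)"
  proof (rule mecke_UN)
    show "mecke (?A i)" for i
    proof (cases "i \<in> ?i ` M")
      case True
      then obtain \<mu> where "\<mu> \<in> M" "i = ?i \<mu>" by blast
      then have "?A i = {\<omega>. finite \<omega> \<and> colours c \<omega> = \<mu>}"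
        using inj by auto
      then show ?thesis using mecke_colours_eq[OF c n] by simp
    next
      case False
      then have "?A i = {}" by auto
      then show ?thesis by (simp only: mecke_empty)
    qed
    show "disjoint_family ?A"
      by (auto simp: disjoint_family_on_def)
  qed
  also have "(\<Union>i. ?A i) = {\<omega>. finite \<omega> \<and> colours c \<omega> \<in> M}"
    by auto
  finally show ?thesis .
qed

lemma mecke_compl:
  assumes A: "mecke A" and sub: "A \<subseteq> {\<omega>. finite \<omega>}"
  shows "mecke ({\<omega>. finite \<omega>} - A)"
proof -
  let ?F = "{\<omega>::'a config. finite \<omega>}"
  have F: "mecke ?F"
    using mecke_colours[of "\<lambda>_. 0" UNIV] by simp
  have [measurable]: "A \<in> sets \<pi>" "?F \<in> sets \<pi>" "del_count A \<in> borel_measurable \<pi>" "del_count ?F \<in> borel_measurable \<pi>"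
    using A F by (auto simp: mecke_def)
  have eq: "del_count (?F - A) = (\<lambda>\<omega>. del_count ?F \<omega> - del_count A \<omega>)"
  proof
    fix \<omega> :: "'a config"
    show "del_count (?F - A) \<omega> = del_count ?F \<omega> - del_count A \<omega>"
    proof (cases "finite \<omega>")
      case True
      have "{x\<in>\<omega>. \<omega> - {x} \<in> ?F - A} = {x\<in>\<omega>. \<omega> - {x} \<in> ?F} - {x\<in>\<omega>. \<omega> - {x} \<in> A}" by auto
      then have "del_count (?F - A) \<omega> = emeasure (count_space \<omega>) ({x\<in>\<omega>. \<omega> - {x} \<in> ?F} - {x\<in>\<omega>. \<omega> - {x} \<in> A})"
        using True by (simp only: del_count_def if_True)
      also have "\<dots> = emeasure (count_space \<omega>) {x\<in>\<omega>. \<omega> - {x} \<in> ?F} - emeasure (count_space \<omega>) {x\<in>\<omega>. \<omega> - {x} \<in> A}"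
        using True sub by (intro emeasure_Diff) (auto simp: emeasure_count_space)
      finally show ?thesis
        using True by (simp only: del_count_def if_True)
    qed (simp add: del_count_def)
  qed
  have le: "del_count A \<omega> \<le> del_count ?F \<omega>" for \<omega>
    using sub by (auto simp: del_count_def intro!: card_mono)
  \<comment> \<open>Subtracting integrals requires a finite subtrahend. By the formula for
    \<open>A\<close> it equals \<sigma>(X) \<pi>(A), which is finite because \<sigma> is.\<close>
  have "(\<integral>\<^sup>+\<omega>. del_count (?F - A) \<omega> \<partial>\<pi>) = emeasure \<sigma> UNIV * emeasure \<pi> ?F - emeasure \<sigma> UNIV * emeasure \<pi> A"
    unfolding eq using A F le
    by (subst nn_integral_diff) (auto simp: mecke_def ennreal_mult_eq_top_iff)
  also have "\<dots> = emeasure \<sigma> UNIV * emeasure \<pi> (?F - A)"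
    using sub by (simp add: emeasure_Diff ennreal_right_diff_distrib)
  finally show ?thesis
    unfolding mecke_def by (auto simp: eq)
qed

text \<open>Colourings with finitely many colours refine each other by pairing, so these events form an
  intersection-stable generator.\<close>

definition colour_events :: "'a config set set" where
  "colour_events = {{\<omega>. finite \<omega> \<and> colours c \<omega> \<in> M} | c M.
     c \<in> borel \<rightarrow>\<^sub>M count_space UNIV \<and> finite (range c)}"

lemma Int_stable_colour_events: "Int_stable colour_events"
proof (rule Int_stableI)
  fix A A' assume "A \<in> colour_events" "A' \<in> colour_events"
  then obtain c M c' M' where c: "c \<in> borel \<rightarrow>\<^sub>M count_space UNIV" "finite (range c)"
      "c' \<in> borel \<rightarrow>\<^sub>M count_space UNIV" "finite (range c')"
    and A: "A = {\<omega>. finite \<omega> \<and> colours c \<omega> \<in> M}" "A' = {\<omega>. finite \<omega> \<and> colours c' \<omega> \<in> M'}"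
    by (auto simp: colour_events_def)
  define d where "d = (\<lambda>x. prod_encode (c x, c' x))"
  have "image_mset (fst \<circ> prod_decode) (colours d \<omega>) = colours c \<omega>"
    "image_mset (snd \<circ> prod_decode) (colours d \<omega>) = colours c' \<omega>" for \<omega>
    by (simp_all add: colours_def d_def multiset.map_comp comp_def)
  then have "A \<inter> A' = {\<omega>. finite \<omega> \<and> colours d \<omega> \<in>
      {\<mu>. image_mset (fst \<circ> prod_decode) \<mu> \<in> M \<and> image_mset (snd \<circ> prod_decode) \<mu> \<in> M'}}"
    by (auto simp: A)
  moreover have "d \<in> borel \<rightarrow>\<^sub>M count_space UNIV"
    unfolding d_def using c by measurable
  moreover have "finite (range d)"
    using c by (rule_tac finite_subset[of _ "prod_encode ` (range c \<times> range c')"]) (auto simp: d_def)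
  ultimately show "A \<inter> A' \<in> colour_events"
    unfolding colour_events_def by blast
qed

lemma Int_finite_in_sigma_colour_events:
  assumes "A \<in> sets \<pi>"
  shows "A \<inter> {\<omega>. finite \<omega>} \<in> sigma_sets {\<omega>. finite \<omega>} colour_events"
  using assms unfolding sets_\<pi>
proof (induction rule: sigma_sets.induct)
  case (Basic A)
  then obtain B C where B: "B \<in> sets borel" and A: "A = {\<omega>\<in>configs. emeasure (config_measure \<omega>) B \<in> C}"
    by auto
  \<comment> \<open>Colour 1 marks \<open>B\<close>, so on finite configurations \<omega>(B) is the
    multiplicity of colour 1, and the generating event becomes a colour event.\<close>
  define c where "c = (\<lambda>x. if x \<in> B then 1 else (0::nat))"
  have "A \<inter> {\<omega>. finite \<omega>} = {\<omega>. finite \<omega> \<and> colours c \<omega> \<in> {\<mu>. of_nat (count \<mu> 1) \<in> C}}"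
  proof -
    have "emeasure (config_measure \<omega>) B = of_nat (count (colours c \<omega>) 1)" if "finite \<omega>" for \<omega>
    proof -
      have "{x\<in>\<omega>. c x = 1} = \<omega> \<inter> B" by (auto simp: c_def)
      then show ?thesis using that B by (simp add: emeasure_config_measure count_colours)
    qed
    then show ?thesis by (auto simp: A finite_in_configs)
  qed
  moreover have "c \<in> borel \<rightarrow>\<^sub>M count_space UNIV"
    unfolding c_def using B by measurable
  moreover have "finite (range c)"
    by (rule finite_subset[of _ "{0, 1}"]) (auto simp: c_def)
  ultimately have "A \<inter> {\<omega>. finite \<omega>} \<in> colour_events"
    unfolding colour_events_def by blast
  then show ?case ..
next
  case Empty
  then show ?case by (simp add: sigma_sets.Empty)
next
  case (Compl A)
  have "(configs - A) \<inter> {\<omega>. finite \<omega>} = {\<omega>. finite \<omega>} - (A \<inter> {\<omega>. finite \<omega>})"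
    using finite_in_configs by auto
  then show ?case using sigma_sets.Compl[OF Compl.IH] by simp
next
  case (Union A)
  then show ?case using sigma_sets.Union[of "\<lambda>i. A i \<inter> {\<omega>. finite \<omega>}"] by simp
qed

lemma mecke_finite:
  assumes "A \<in> sets \<pi>"
  shows "mecke (A \<inter> {\<omega>. finite \<omega>})"
proof -
  have closed: "colour_events \<subseteq> Pow {\<omega>. finite \<omega>}"
    by (auto simp: colour_events_def)
  show ?thesis
    using Int_stable_colour_events closed Int_finite_in_sigma_colour_events[OF assms]
  proof (rule sigma_sets_induct_disjoint)
    show "mecke A" if "A \<in> colour_events" for A
      using that by (auto simp: colour_events_def intro: mecke_colours)
    show "mecke ({\<omega>. finite \<omega>} - A)" if "A \<in> sigma_sets {\<omega>. finite \<omega>} colour_events" "mecke A" for A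
      using that sigma_sets_into_sp[OF closed] by (intro mecke_compl) auto
  qed (auto intro: mecke_UN mecke_empty)
qed

end

section \<open>Gradients and the constant $k_p^+$\<close>

lemma sets_half_sum [measurable_cong]: "sets (half_sum \<sigma> \<omega>) = sets borel"
  using sets.sigma_sets_eq[of "borel :: 'a::metric_space measure"]
  by (simp add: half_sum_def sets_measure_of_conv)

lemma space_half_sum [simp]: "space (half_sum \<sigma> \<omega>) = UNIV"
  by (simp add: half_sum_def space_measure_of_conv)

text \<open>\<open>measure_of\<close> falls back to the zero measure on set functions that are not
  countably additive, so additivity has to be established before the formula may be read
  off.\<close>

lemma emeasure_half_sum:
  fixes \<sigma> :: "'a::metric_space measure"
  assumes \<sigma>: "sets \<sigma> = sets borel" and B: "B \<in> sets borel"
  shows "emeasure (half_sum \<sigma> \<omega>) B = (emeasure \<sigma> B + emeasure (config_measure \<omega>) B) / 2"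
proof -
  let ?m = "\<lambda>B. (emeasure \<sigma> B + emeasure (config_measure \<omega>) B) / 2"
  have \<omega>: "sets (config_measure \<omega>) = sets borel"
    by (simp add: config_measure_def)
  have "countably_additive (sets borel) ?m"
  proof (rule countably_additiveI)
    fix A :: "nat \<Rightarrow> 'a set"
    assume "range A \<subseteq> sets borel" "disjoint_family A"
    then have "(\<Sum>i. emeasure \<sigma> (A i)) = emeasure \<sigma> (\<Union>i. A i)"
      "(\<Sum>i. emeasure (config_measure \<omega>) (A i)) = emeasure (config_measure \<omega>) (\<Union>i. A i)"
      using \<sigma> \<omega> by (simp_all add: suminf_emeasure)
    then show "(\<Sum>i. ?m (A i)) = ?m (\<Union>i. A i)"
      by (simp add: divide_ennreal_def suminf_add[symmetric])
  qed
  then show ?thesis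
    using B unfolding half_sum_def
    using sets.sigma_sets_eq[of "borel :: 'a measure"]
    by (subst emeasure_measure_of[OF refl]) (auto simp: positive_def)
qed

lemma (in prob_space) is_median_AE_const:
  assumes F: "F \<in> borel_measurable M" and m: "is_median M F m" and c: "AE \<omega> in M. F \<omega> = c"
  shows "c = m"
proof (rule ccontr)
  assume "c \<noteq> m"
  note [measurable] = F
  from \<open>c \<noteq> m\<close> consider "c > m" | "c < m" by linarith
  then show False
  proof cases
    case 1
    then have "AE \<omega> in M. \<not> F \<omega> \<le> m" using c by auto
    then have "prob {\<omega>\<in>space M. F \<omega> \<le> m} = 0"
      by (subst prob_eq_0) auto
    then show False using m by (simp add: is_median_def)
  next
    case 2
    then have "AE \<omega> in M. \<not> F \<omega> \<ge> m" using c by auto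
    then have "prob {\<omega>\<in>space M. F \<omega> \<ge> m} = 0"
      by (subst prob_eq_0) auto
    then show False using m by (simp add: is_median_def)
  qed
qed

section \<open>Deletion of points, lower bounds for gradient norms, and finiteness of k_p^+\<close>

context poisson_process
begin

text \<open>By the Mecke formula the expected number of points whose removal leads into a null set Z
  is \<sigma>(X) \<pi>(Z) = 0, so almost surely there is no such point.\<close>

lemma AE_remove_point:
  assumes "AE \<omega> in \<pi>. P \<omega>"
  shows "AE \<omega> in \<pi>. \<forall>x\<in>\<omega>. P (\<omega> - {x})"
proof -
  obtain Z where Z: "Z \<in> null_sets \<pi>" "{\<omega>\<in>configs. \<not> P \<omega>} \<subseteq> Z"
    using assms by (auto simp: eventually_ae_filter)
  let ?A = "Z \<inter> {\<omega>. finite \<omega>}"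
  have "?A \<in> null_sets \<pi>"
    using Z(1) sets_finite by (rule null_set_Int2)
  moreover have m: "mecke ?A"
    using Z(1) by (intro mecke_finite) auto
  ultimately have "(\<integral>\<^sup>+\<omega>. del_count ?A \<omega> \<partial>\<pi>) = 0"
    by (simp add: mecke_def null_sets_def)
  then have "AE \<omega> in \<pi>. del_count ?A \<omega> = 0"
    using m by (subst (asm) nn_integral_0_iff_AE) (auto simp: mecke_def)
  with AE_finite show ?thesis
  proof eventually_elim
    case (elim \<omega>)
    then have empty: "{x\<in>\<omega>. \<omega> - {x} \<in> ?A} = {}"
      by (auto simp: del_count_def)
    show ?case
    proof
      fix x assume "x \<in> \<omega>"
      with empty elim(1) have "\<omega> - {x} \<notin> Z" by auto
      moreover have "\<omega> - {x} \<in> configs" using elim(1) by (intro finite_in_configs) simp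
      ultimately show "P (\<omega> - {x})" using Z(2) by blast
    qed
  qed
qed

lemma AE_const_of_remove_invariant:
  assumes "AE \<omega> in \<pi>. \<forall>x\<in>\<omega>. F (\<omega> - {x}) = F \<omega>"
  shows "AE \<omega> in \<pi>. F \<omega> = F {}"
proof -
  \<comment> \<open>\<open>R k \<omega>\<close> says that after any k successive deletions one
    further deletion leaves \<open>F\<close> unchanged. A single level is not inherited by \<omega>
    - {x}, but all levels together are, and this drives the induction down to the empty
    configuration.\<close>
  define R where "R k = ((\<lambda>P \<omega>. \<forall>x\<in>\<omega>. P (\<omega> - {x})) ^^ k) (\<lambda>\<omega>. \<forall>x\<in>\<omega>. F (\<omega> - {x}) = F \<omega>)" for k
  have "AE \<omega> in \<pi>. R k \<omega>" for k
  proof (induction k)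
    case (Suc k)
    from AE_remove_point[OF this] show ?case by (simp add: R_def)
  qed (simp add: R_def assms)
  then have "AE \<omega> in \<pi>. \<forall>k. R k \<omega>"
    by (simp add: AE_all_countable)
  moreover have "F \<omega> = F {}" if "finite \<omega>" "\<forall>k. R k \<omega>" for \<omega>
    using that
  proof (induction \<omega> rule: finite_psubset_induct)
    case (psubset \<omega>)
    show ?case
    proof (cases "\<omega> = {}")
      case False
      then obtain x where x: "x \<in> \<omega>" by auto
      have "R k (\<omega> - {x})" for k
        using psubset.prems[rule_format, of "Suc k"] x by (simp add: R_def)
      then have "F (\<omega> - {x}) = F {}"
        using x by (intro psubset.IH) auto
      moreover have "F (\<omega> - {x}) = F \<omega>"
        using psubset.prems[rule_format, of 0] x by (simp add: R_def)
      ultimately show ?thesis by simp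
    qed simp
  qed
  ultimately show ?thesis
    using AE_finite by (auto elim!: eventually_mono[OF eventually_conj])
qed

text \<open>The quantifier over x depends on \<omega> and is not countable in advance. Measurability
  comes from rewriting it as \<open>del_count\<close> being non-zero, which the Mecke induction has
  shown to be measurable.\<close>

lemma jump_event:
  fixes q r :: real
  assumes [measurable]: "F \<in> borel_measurable \<pi>"
  shows "{\<omega>. finite \<omega> \<and> r < F \<omega> \<and> (\<exists>x\<in>\<omega>. F (\<omega> - {x}) < q)} \<in> sets \<pi>"
proof -
  let ?A = "{\<omega>\<in>space \<pi>. F \<omega> < q} \<inter> {\<omega>. finite \<omega>}"
  have [measurable]: "del_count ?A \<in> borel_measurable \<pi>"
  proof -
    have "{\<omega>\<in>space \<pi>. F \<omega> < q} \<in> sets \<pi>" by measurable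
    from mecke_finite[OF this] show ?thesis by (simp only: mecke_def)
  qed
  have "del_count ?A \<omega> \<noteq> 0 \<longleftrightarrow> (\<exists>x\<in>\<omega>. F (\<omega> - {x}) < q)" if "finite \<omega>" for \<omega>
    using that by (auto simp: del_count_def card_eq_0_iff finite_in_configs)
  then have "{\<omega>. finite \<omega> \<and> r < F \<omega> \<and> (\<exists>x\<in>\<omega>. F (\<omega> - {x}) < q)} =
      {\<omega>\<in>space \<pi>. r < F \<omega> \<and> del_count ?A \<omega> \<noteq> 0} \<inter> {\<omega>. finite \<omega>}"
    by (auto simp: finite_in_configs)
  also have "\<dots> \<in> sets \<pi>"
    by (intro sets.Int sets_finite) measurable
  finally show ?thesis .
qed

text \<open>The contrapositive of constancy under deletions, made quantitative. A measurable event
  with a uniform bound e is required because the gradient norm itself need not be measurable, and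
  its lower integral must be bounded from below.\<close>

lemma not_AE_const_imp_large_gradient:
  assumes F: "F \<in> borel_measurable \<pi>" and nc: "\<not> (\<exists>c. AE \<omega> in \<pi>. F \<omega> = c)"
  obtains e E where "0 < e" "E \<in> sets \<pi>" "0 < prob E"
    "\<And>\<omega>. \<omega> \<in> E \<Longrightarrow> finite \<omega> \<and> (\<exists>x\<in>\<omega>. e \<le> \<bar>D F x \<omega>\<bar>)"
proof -
  \<comment> \<open>A deletion takes G from above r to below q. Using -F beside F covers both signs,
    rational q < r keep the family countable, and r - q becomes the uniform bound e.\<close>
  define J where "J G q r = {\<omega>. finite \<omega> \<and> r < G \<omega> \<and> (\<exists>x\<in>\<omega>. G (\<omega> - {x}) < q)}"
    for G :: "'a config \<Rightarrow> real" and q r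
  have JF: "J F q r \<in> sets \<pi>" "J (\<lambda>\<omega>. - F \<omega>) q r \<in> sets \<pi>" for q r
    unfolding J_def using F by (auto intro!: jump_event)
  have "\<exists>q\<in>\<rat>. \<exists>r\<in>\<rat>. \<exists>G\<in>{F, \<lambda>\<omega>. - F \<omega>}. q < r \<and> 0 < prob (J G q r)"
  proof (rule ccontr)
    assume "\<not> ?thesis"
    then have "prob (J G q r) = 0" if "q \<in> \<rat>" "r \<in> \<rat>" "q < r" "G \<in> {F, \<lambda>\<omega>. - F \<omega>}" for q r G
      using that by (metis zero_less_measure_iff)
    then have null: "AE \<omega> in \<pi>. \<omega> \<notin> J G q r" if "q \<in> \<rat>" "r \<in> \<rat>" "q < r" "G \<in> {F, \<lambda>\<omega>. - F \<omega>}" for q r G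
      using that JF by (intro AE_not_in) (auto simp: null_sets_def emeasure_eq_measure)
    have S: "countable {F, \<lambda>\<omega>. - F \<omega>}" by simp
    have "AE \<omega> in \<pi>. \<forall>q\<in>\<rat>. \<forall>r\<in>\<rat>. \<forall>G\<in>{F, \<lambda>\<omega>. - F \<omega>}. q < r \<longrightarrow> \<omega> \<notin> J G q r"
      unfolding AE_ball_countable[OF countable_rat] AE_ball_countable[OF S]
      by (intro ballI AE_impI null)
    with AE_finite have "AE \<omega> in \<pi>. \<forall>x\<in>\<omega>. F (\<omega> - {x}) = F \<omega>"
    proof eventually_elim
      case (elim \<omega>)
      have "\<not> G (\<omega> - {x}) < G \<omega>" if x: "x \<in> \<omega>" and G: "G \<in> {F, \<lambda>\<omega>. - F \<omega>}" for x G
      proof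
        assume "G (\<omega> - {x}) < G \<omega>"
        then obtain q where q: "q \<in> \<rat>" "G (\<omega> - {x}) < q" "q < G \<omega>" using Rats_dense_in_real by blast
        then obtain r where "r \<in> \<rat>" "q < r" "r < G \<omega>" using Rats_dense_in_real by blast
        with elim q x G show False by (auto simp: J_def)
      qed
      from this[of _ F] this[of _ "\<lambda>\<omega>. - F \<omega>"] show ?case
        by (auto simp: antisym_conv3)
    qed
    then show False using nc AE_const_of_remove_invariant by blast
  qed
  then obtain q r G where "q < r" "G \<in> {F, \<lambda>\<omega>. - F \<omega>}" "0 < prob (J G q r)" by blast
  then show thesis
    using JF by (intro that[of "r - q" "J G q r"]) (auto simp: J_def D_def intro!: bexI)
qed

text \<open>The factor 1/2 is the mass that (\<sigma> + \<omega>)/2 puts at least on each point of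
  \<omega>.\<close>

lemma grad_norm_ge_jump:
  assumes "1 \<le> p" "finite \<omega>" "x \<in> \<omega>"
  shows "ennreal (\<bar>D F x \<omega>\<bar> / 2) \<le> grad_norm p \<sigma> F \<omega>"
proof -
  have "emeasure (config_measure \<omega>) {x} = 1"
    using assms by (simp add: emeasure_config_measure)
  moreover have "ennreal (1 / 2) = 1 / 2"
    by (metis divide_ennreal ennreal_1 ennreal_numeral zero_le_numeral zero_less_numeral zero_le_one)
  ultimately have "ennreal (1 / 2) \<le> emeasure (half_sum \<sigma> \<omega>) {x}"
    by (simp add: emeasure_half_sum sets_\<sigma> divide_right_mono_ennreal)
  from Lp_norm_ge_atom[OF assms(1) _ _ _ this] show ?thesis
    by (simp add: grad_norm_def sets_half_sum)
qed

text \<open>Needed for $p = \infty$, since \<open>esssup\<close> is \<open>\<top>\<close> on non-measurable functions.\<close>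

lemma measurable_insert_point:
  assumes \<omega>: "finite \<omega>"
  shows "(\<lambda>x. insert x \<omega>) \<in> borel \<rightarrow>\<^sub>M \<pi>"
proof (rule measurable_sigma_sets[OF sets_\<pi>])
  show "(\<lambda>x. insert x \<omega>) \<in> space borel \<rightarrow> configs"
    using \<omega> by (auto simp: finite_in_configs)
  fix Y :: "'a config set" assume "Y \<in> {{\<omega>\<in>configs. emeasure (config_measure \<omega>) B \<in> C} | B C.
     B \<in> sets borel \<and> C \<in> sets (borel :: ennreal measure)}"
  then obtain B C where B: "B \<in> sets borel" and C: "C \<in> sets (borel :: ennreal measure)"
    and Y: "Y = {\<omega>\<in>configs. emeasure (config_measure \<omega>) B \<in> C}" by auto
  \<comment> \<open>This is the count of \<open>B\<close> after inserting x, except when x already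
    lies in the finite set \<omega>; such an exceptional set does not affect measurability.\<close>
  have "(\<lambda>x. of_nat (card (\<omega> \<inter> B)) + indicator B x :: ennreal) \<in> borel_measurable borel"
    using B by measurable
  then have "(\<lambda>x. emeasure (config_measure (insert x \<omega>)) B) \<in> borel_measurable borel"
  proof (rule measurable_discrete_difference[where X=\<omega>])
    show "of_nat (card (\<omega> \<inter> B)) + indicator B x = emeasure (config_measure (insert x \<omega>)) B"
      if "x \<notin> \<omega>" for x
      using that \<omega> B by (cases "x \<in> B") (auto simp: emeasure_config_measure)
  qed (use \<omega> countable_finite in auto)
  from measurable_sets[OF this C]
  show "(\<lambda>x. insert x \<omega>) -` Y \<inter> space borel \<in> sets borel"
    using \<omega> by (simp add: Y vimage_def finite_in_configs)
qed auto

lemma measurable_D: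
  assumes F: "F \<in> borel_measurable \<pi>" and \<omega>: "finite \<omega>"
  shows "(\<lambda>x. D F x \<omega>) \<in> borel_measurable borel"
proof -
  have "(\<lambda>x. F \<omega> - F (insert x \<omega>)) \<in> borel_measurable borel"
    using measurable_compose[OF measurable_insert_point[OF \<omega>] F] by simp
  then show ?thesis
    by (rule measurable_discrete_difference[where X=\<omega>]) (use \<omega> countable_finite in \<open>auto simp: D_def\<close>)
qed

lemma grad_norm_le:
  assumes F: "F \<in> borel_measurable \<pi>" "G \<in> borel_measurable \<pi>" and \<omega>: "finite \<omega>"
    and p: "1 \<le> p" and a: "0 \<le> a" "\<And>x. \<bar>D G x \<omega>\<bar> \<le> a * \<bar>D F x \<omega>\<bar>"
  shows "grad_norm p \<sigma> G \<omega> \<le> ennreal a * grad_norm p \<sigma> F \<omega>"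
  unfolding grad_norm_def using measurable_D[OF F(1) \<omega>] measurable_D[OF F(2) \<omega>] a p
  by (intro Lp_norm_le) (simp_all cong: measurable_cong_sets[OF sets_half_sum refl])

lemma grad_plus_norm_le:
  assumes F: "F \<in> borel_measurable \<pi>" "G \<in> borel_measurable \<pi>" and \<omega>: "finite \<omega>"
    and p: "1 \<le> p" and a: "0 \<le> a" "\<And>x. D_plus G x \<omega> \<le> a * \<bar>D F x \<omega>\<bar>"
  shows "grad_plus_norm p \<sigma> G \<omega> \<le> ennreal a * grad_norm p \<sigma> F \<omega>"
proof -
  have "\<bar>D_plus G x \<omega>\<bar> = D_plus G x \<omega>" for x
    by (simp add: D_plus_def)
  moreover have "(\<lambda>x. D_plus G x \<omega>) \<in> borel_measurable borel"
    unfolding D_plus_def using measurable_D[OF F(2) \<omega>] by measurable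
  ultimately show ?thesis
    unfolding grad_norm_def grad_plus_norm_def using measurable_D[OF F(1) \<omega>] a p
    by (intro Lp_norm_le) (simp_all cong: measurable_cong_sets[OF sets_half_sum refl])
qed

text \<open>The product form of the infimum absorbs the non-constancy condition: an almost surely
  constant \<open>F\<close> equals its median m, so the factor multiplying \<open>k_plus\<close> is
  0.\<close>

lemma k_plus_le:
  assumes F: "F \<in> borel_measurable \<pi>" and m: "is_median \<pi> F m"
    and fin: "(\<integral>\<^sup>+\<omega>. ennreal (max 0 (F \<omega> - m)) \<partial>\<pi>) < \<infinity>"
  shows "k_plus p \<sigma> \<pi> * (\<integral>\<^sup>+\<omega>. ennreal (max 0 (F \<omega> - m)) \<partial>\<pi>) \<le> (\<integral>\<^sup>+\<omega>. grad_plus_norm p \<sigma> F \<omega> \<partial>\<pi>)"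
    (is "_ * ?b \<le> ?a")
proof (cases "?b = 0")
  case False
  have "\<not> (\<exists>c. AE \<omega> in \<pi>. F \<omega> = c)"
  proof
    assume "\<exists>c. AE \<omega> in \<pi>. F \<omega> = c"
    then have "AE \<omega> in \<pi>. F \<omega> = m"
      using is_median_AE_const[OF F m] by blast
    then have "AE \<omega> in \<pi>. ennreal (max 0 (F \<omega> - m)) = 0"
      by eventually_elim simp
    then show False using False F by (simp add: nn_integral_0_iff_AE)
  qed
  then have "k_plus p \<sigma> \<pi> \<le> ?a / ?b"
    unfolding k_plus_def using F m fin by (intro Inf_lower) blast
  then have "k_plus p \<sigma> \<pi> * ?b \<le> ?a / ?b * ?b"
    by (rule mult_right_mono) simp
  also have "\<dots> = ?a * ?b / ?b"
    by (simp only: mult.commute[of _ ?b] ennreal_times_divide)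
  also have "\<dots> = ?a"
    using False fin by (intro mult_divide_eq_ennreal) auto
  finally show ?thesis .
qed simp

text \<open>One of the events $\omega = \emptyset$ and $\omega \ne \emptyset$ has probability at most $1/2$; its
  indicator has median $0$, and a positive gradient vanishing on configurations with at least two
  points, so that the gradient norm is bounded although $\omega(X)$ is not.\<close>

lemma k_plus_less_top:
  assumes \<sigma>: "emeasure \<sigma> UNIV \<noteq> 0" and p: "1 \<le> p"
  shows "k_plus p \<sigma> \<pi> < \<infinity>"
proof -
  let ?s = "measure \<sigma> UNIV"
  define q where "q = prob {{}}"
  have void: "{{}} = {\<omega>\<in>configs. emeasure (config_measure \<omega>) UNIV = of_nat 0}"
    using finite_in_configs[of "{}"] by (auto simp: emeasure_config_measure split: if_splits)
  have "?s > 0"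
    using \<sigma> by (simp add: \<sigma>.emeasure_eq_measure zero_less_measure_iff)
  moreover have "q = exp (- ?s)"
    unfolding q_def void by (subst prob_count) auto
  ultimately have q: "0 < q" "q < 1" by auto
  have e: "{{}} \<in> sets \<pi>"
    unfolding void by (rule sets_count) simp
  \<comment> \<open>The last two conditions say that, from a configuration with at least two points,
    adding or removing one point never leaves \<open>A\<close>; so the indicator does not decrease
    there and \<open>D_plus\<close> is 0.\<close>
  have *: "k_plus p \<sigma> \<pi> < \<infinity>"
    if A: "A \<in> sets \<pi>" "0 < prob A" "prob A \<le> 1 / 2"
      and A0: "\<And>x \<omega>. finite \<omega> \<Longrightarrow> 1 < card \<omega> \<Longrightarrow> x \<in> \<omega> \<Longrightarrow> \<omega> \<in> A \<Longrightarrow> \<omega> - {x} \<in> A"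
      and A1: "\<And>x \<omega>. finite \<omega> \<Longrightarrow> 1 < card \<omega> \<Longrightarrow> x \<notin> \<omega> \<Longrightarrow> \<omega> \<in> A \<Longrightarrow> insert x \<omega> \<in> A" for A
  proof -
    let ?F = "indicator A :: 'a config \<Rightarrow> real"
    have F: "?F \<in> borel_measurable \<pi>" using A by simp
    have "{\<omega>\<in>space \<pi>. ?F \<omega> \<le> 0} = space \<pi> - A"
      by (auto split: split_indicator)
    moreover have "prob (configs - A) = 1 - prob A"
      using prob_compl[OF A(1)] by simp
    moreover have "{\<omega>\<in>configs. ?F \<omega> \<ge> 0} = space \<pi>"
      by (auto split: split_indicator)
    ultimately have "is_median \<pi> ?F 0"
      using A(3) by (simp add: is_median_def prob_space del: space_\<pi>) (simp add: prob_space[simplified])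
    moreover have int: "(\<integral>\<^sup>+\<omega>. ennreal (max 0 (?F \<omega> - 0)) \<partial>\<pi>) = ennreal (prob A)"
    proof -
      have "(\<integral>\<^sup>+\<omega>. ennreal (max 0 (?F \<omega> - 0)) \<partial>\<pi>) = (\<integral>\<^sup>+\<omega>. indicator A \<omega> \<partial>\<pi>)"
        by (intro nn_integral_cong) (auto split: split_indicator)
      then show ?thesis using A by (simp add: emeasure_eq_measure)
    qed
    ultimately have "k_plus p \<sigma> \<pi> * ennreal (prob A) \<le> (\<integral>\<^sup>+\<omega>. grad_plus_norm p \<sigma> ?F \<omega> \<partial>\<pi>)"
      using k_plus_le[OF F, of 0] by simp
    \<comment> \<open>With at most one point, (\<sigma> + \<omega>)/2 has mass at most (s + 1)/2;
      the leading 1 comes from \<open>Lp_norm_le_mass\<close>.\<close>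
    also have "\<dots> \<le> (\<integral>\<^sup>+\<omega>. ennreal (1 + (?s + 1) / 2) \<partial>\<pi>)"
    proof (rule nn_integral_mono_AE)
      show "AE \<omega> in \<pi>. grad_plus_norm p \<sigma> ?F \<omega> \<le> ennreal (1 + (?s + 1) / 2)"
        using AE_finite
      proof eventually_elim
        case (elim \<omega>)
        show ?case
        proof (cases "1 < card \<omega>")
          case True
          have "D_plus ?F x \<omega> = 0" for x
            using A0[OF elim True, of x] A1[OF elim True, of x] by (auto simp: D_plus_def D_def split: split_indicator)
          then show ?thesis using p by (simp add: grad_plus_norm_def)
        next
          case False
          have m: "(\<lambda>x. D_plus ?F x \<omega>) \<in> borel_measurable borel"
            unfolding D_plus_def using measurable_D[OF F elim] by measurable
          show ?thesis
            unfolding grad_plus_norm_def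
          proof (rule Lp_norm_le_mass)
            show "(\<lambda>x. D_plus ?F x \<omega>) \<in> borel_measurable (half_sum \<sigma> \<omega>)"
              using m by (simp cong: measurable_cong_sets[OF sets_half_sum refl])
            show "\<bar>D_plus ?F x \<omega>\<bar> \<le> 1" for x
              by (auto simp: D_plus_def D_def split: split_indicator)
            have "emeasure (half_sum \<sigma> \<omega>) UNIV = (ennreal ?s + of_nat (card \<omega>)) / 2"
              using elim by (simp add: emeasure_half_sum sets_\<sigma> emeasure_config_measure \<sigma>.emeasure_eq_measure)
            also have "\<dots> \<le> (ennreal ?s + 1) / 2"
              using False by (intro divide_right_mono_ennreal add_left_mono) (auto simp: le_Suc_eq not_less)
            also have "\<dots> = ennreal ((?s + 1) / 2)"
              by (simp add: divide_ennreal[symmetric] ennreal_plus)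
            finally show "emeasure (half_sum \<sigma> \<omega>) (space (half_sum \<sigma> \<omega>)) \<le> ennreal ((?s + 1) / 2)"
              by simp
          qed (use p in auto)
        qed
      qed
    qed
    also have "\<dots> < \<infinity>"
      using emeasure_space_1 by simp
    finally show ?thesis
      using A(2) by (auto simp: ennreal_mult_less_top less_top[symmetric] ennreal_top_mult)
  qed
  show ?thesis
  proof (cases "q \<le> 1 / 2")
    case True
    then show ?thesis
      using q e by (intro *[of "{{}}"]) (auto simp: q_def)
  next
    case False
    show ?thesis
    proof (rule *[of "space \<pi> - {{}}"])
      show "0 < prob (space \<pi> - {{}})" "prob (space \<pi> - {{}}) \<le> 1 / 2"
        using q False unfolding prob_compl[OF e] by (simp_all add: q_def)
      show "\<omega> - {x} \<in> space \<pi> - {{}}" if "finite \<omega>" "1 < card \<omega>" "x \<in> \<omega>" for x \<omega>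
        using that card_mono[of "{x}" \<omega>] by (auto simp: finite_in_configs)
      show "space \<pi> - {{}} \<in> sets \<pi>"
        using e by (rule sets.compl_sets)
    qed (auto simp: finite_in_configs)
  qed
qed

lemma AE_empty:
  assumes "emeasure \<sigma> UNIV = 0"
  shows "AE \<omega> in \<pi>. \<omega> = {}"
proof -
  let ?E = "{\<omega>\<in>configs. emeasure (config_measure \<omega>) UNIV = of_nat 0}"
  have "prob ?E = 1"
    using assms by (subst prob_count) (auto simp: measure_def)
  moreover have "?E \<in> sets \<pi>"
    by (rule sets_count) simp
  ultimately have "AE \<omega> in \<pi>. \<omega> \<in> ?E"
    by (subst AE_in_set_eq_1) auto
  then show ?thesis
    by eventually_elim (auto simp: emeasure_config_measure split: if_splits)
qed

end

section \<open>Young functions\<close>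

lemma young_right_deriv_pos:
  assumes N: "young_function N" and x: "0 < x"
  shows "0 < right_deriv N x" "N x \<le> right_deriv N x * x"
proof -
  show *: "N x \<le> right_deriv N x * x"
    using N convex_right_deriv_subgradient[of N x 0] by (simp add: young_function_def)
  have "0 < N x" using N x by (simp add: young_function_def)
  with * have "0 < right_deriv N x * x" by linarith
  then show "0 < right_deriv N x" using x by (simp add: zero_less_mult_iff)
qed

lemma young_mono:
  assumes N: "young_function N" and xy: "\<bar>x\<bar> \<le> \<bar>y\<bar>"
  shows "N x \<le> N y"
proof -
  have abs: "N \<bar>x\<bar> = N x" for x using N by (auto simp: abs_if young_function_def)
  have "N \<bar>x\<bar> \<le> N \<bar>y\<bar>"
  proof (cases "x = 0")
    case False
    then have "0 \<le> right_deriv N \<bar>x\<bar> * (\<bar>y\<bar> - \<bar>x\<bar>)"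
      using young_right_deriv_pos(1)[OF N, of "\<bar>x\<bar>"] xy by simp
    then show ?thesis
      using N convex_right_deriv_subgradient[of N "\<bar>x\<bar>" "\<bar>y\<bar>"] by (simp add: young_function_def)
  qed (use N in \<open>simp add: young_function_def\<close>)
  then show ?thesis by (simp add: abs)
qed

text \<open>The tangent at 1 has slope at least \<open>N 1\<close>, since it passes below the
  origin. This linear growth gives the positive lower bound on the Orlicz norm of the
  gradient.\<close>

lemma young_ge_linear:
  assumes N: "young_function N" and y: "1 \<le> y"
  shows "N 1 * y \<le> N y"
proof -
  have "N 1 * (y - 1) \<le> right_deriv N 1 * (y - 1)"
    using young_right_deriv_pos(2)[OF N, of 1] y by (intro mult_right_mono) auto
  then show ?thesis
    using N convex_right_deriv_subgradient[of N 1 y] by (simp add: young_function_def algebra_simps)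
qed

lemma borel_measurable_young: "young_function N \<Longrightarrow> N \<in> borel_measurable borel"
  by (auto simp: young_function_def intro!: borel_measurable_continuous_onI convex_on_continuous)

text \<open>The subgradient inequality bounds N'(x) (y - x), and the definition of C bounds x N'(x)
  by C N(x); together they replace Young's inequality with a conjugate function. The bound 1 <= C
  keeps C - 1 from being cut off at 0 in \<open>ennreal\<close>.\<close>

lemma young_const_bound:
  assumes N: "young_function N" and fin: "young_const N < \<infinity>"
  obtains C where "young_const N = ennreal C" "1 \<le> C"
    "\<And>x y. 0 < x \<Longrightarrow> right_deriv N x * y \<le> N y + (C - 1) * N x"
proof
  let ?C = "enn2real (young_const N)"
  show C: "young_const N = ennreal ?C" using fin by simp
  have le: "right_deriv N x * x \<le> ?C * N x" if "0 < x" for x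
  proof -
    have "ennreal (x * right_deriv N x / N x) \<le> young_const N"
      unfolding young_const_def using that by (intro SUP_upper) auto
    then have "x * right_deriv N x / N x \<le> ?C"
      by (subst (asm) C) (simp add: ennreal_le_iff)
    moreover have "0 < N x" using N that by (simp add: young_function_def)
    ultimately show ?thesis by (simp add: field_simps)
  qed
  show "1 \<le> ?C"
  proof -
    have "N 1 \<le> ?C * N 1" using young_right_deriv_pos(2)[OF N, of 1] le[of 1] by simp
    moreover have "0 < N 1" using N by (simp add: young_function_def)
    ultimately show ?thesis by simp
  qed
  show "right_deriv N x * y \<le> N y + (?C - 1) * N x" if "0 < x" for x y
    using le[OF that] N convex_right_deriv_subgradient[of N x y]
    by (simp add: young_function_def algebra_simps)
qed

lemma young_ext_ereal: "young_ext N (ereal r) = ennreal (N r)"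
  by (simp add: young_ext_def)

lemma young_ext_infinity: "young_ext N \<infinity> = \<top>"
  by (simp add: young_ext_def)

lemma young_ext_mono:
  assumes N: "young_function N" and ab: "a \<le> b"
  shows "young_ext N (enn2ereal a) \<le> young_ext N (enn2ereal b)"
proof (cases b)
  case (real s)
  with ab obtain r where "a = ennreal r" "0 \<le> r" "r \<le> s"
    by (cases a) (auto simp: ennreal_le_iff top_unique)
  then show ?thesis
    using real young_mono[OF N, of r s] by (simp add: young_ext_ereal ennreal_leI)
qed (simp add: young_ext_infinity)

lemma is_median_zero_uminus:
  "is_median M F 0 \<Longrightarrow> is_median M (\<lambda>\<omega>. - F \<omega>) 0"
  by (simp add: is_median_def)

lemma is_median_zero_cong:
  assumes "is_median M F 0" "\<And>\<omega>. F \<omega> \<le> 0 \<longleftrightarrow> G \<omega> \<le> 0" "\<And>\<omega>. F \<omega> \<ge> 0 \<longleftrightarrow> G \<omega> \<ge> 0"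
  shows "is_median M G 0"
  using assms by (simp add: is_median_def)

lemma D_uminus: "D (\<lambda>\<omega>. - F \<omega>) x \<omega> = - D F x \<omega>"
  by (simp add: D_def)

lemma grad_norm_uminus: "grad_norm p \<sigma> (\<lambda>\<omega>. - F \<omega>) \<omega> = grad_norm p \<sigma> F \<omega>"
  by (simp add: grad_norm_def D_uminus Lp_norm_def cong: if_cong)

section \<open>The modular and Orlicz inequalities\<close>

context poisson_process
begin

lemma k_plus_times_young_le:
  assumes N: "young_function N" and p: "1 \<le> p"
    and F [measurable]: "F \<in> borel_measurable \<pi>" and m: "is_median \<pi> F 0" and b: "\<And>\<omega>. F \<omega> \<le> b"
  shows "k_plus p \<sigma> \<pi> * (\<integral>\<^sup>+\<omega>. ennreal (N (max 0 (F \<omega>))) \<partial>\<pi>) \<le>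
    (\<integral>\<^sup>+\<omega>. (if 0 < F \<omega> then ennreal (right_deriv N (F \<omega>)) * grad_norm p \<sigma> F \<omega> else 0) \<partial>\<pi>)"
proof -
  note [measurable] = borel_measurable_young[OF N]
  let ?G = "\<lambda>\<omega>. N (max 0 (F \<omega>))"
  have N0: "N 0 = 0" "0 \<le> N x" for x
    using N by (auto simp: young_function_def)
  have G [measurable]: "?G \<in> borel_measurable \<pi>" by measurable
  \<comment> \<open>N(F^+) vanishes wherever F <= 0, so 0 is still a median.\<close>
  have "{\<omega>\<in>space \<pi>. ?G \<omega> \<le> 0} \<in> sets \<pi>"
    by measurable
  then have "prob {\<omega>\<in>space \<pi>. F \<omega> \<le> 0} \<le> prob {\<omega>\<in>space \<pi>. ?G \<omega> \<le> 0}"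
    by (rule finite_measure_mono[rotated]) (auto simp: N0)
  moreover have "{\<omega>\<in>space \<pi>. ?G \<omega> \<ge> 0} = space \<pi>"
    using N0 by auto
  ultimately have med: "is_median \<pi> ?G 0"
    using m by (simp add: is_median_def prob_space[simplified])
  \<comment> \<open>The upper bound b makes E[N(F^+)] finite, as the infimum in
    \<open>k_plus\<close> demands.\<close>
  have "ennreal (N (max 0 (F \<omega>))) \<le> ennreal (N (max 0 b))" for \<omega>
    using b[of \<omega>] by (intro ennreal_leI young_mono[OF N]) auto
  then have "(\<integral>\<^sup>+\<omega>. ennreal (?G \<omega>) \<partial>\<pi>) \<le> (\<integral>\<^sup>+\<omega>. ennreal (N (max 0 b)) \<partial>\<pi>)"
    by (intro nn_integral_mono) auto
  also have "\<dots> < \<infinity>"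
    using emeasure_space_1 by simp
  finally have fin: "(\<integral>\<^sup>+\<omega>. ennreal (?G \<omega>) \<partial>\<pi>) < \<infinity>" .
  have "k_plus p \<sigma> \<pi> * (\<integral>\<^sup>+\<omega>. ennreal (?G \<omega>) \<partial>\<pi>) \<le> (\<integral>\<^sup>+\<omega>. grad_plus_norm p \<sigma> ?G \<omega> \<partial>\<pi>)"
    using k_plus_le[OF G med, of p] fin by (simp add: N0 max_absorb2)
  also have "\<dots> \<le> (\<integral>\<^sup>+\<omega>. (if 0 < F \<omega> then ennreal (right_deriv N (F \<omega>)) * grad_norm p \<sigma> F \<omega> else 0) \<partial>\<pi>)"
  proof (rule nn_integral_mono_AE)
    show "AE \<omega> in \<pi>. grad_plus_norm p \<sigma> ?G \<omega> \<le>
        (if 0 < F \<omega> then ennreal (right_deriv N (F \<omega>)) * grad_norm p \<sigma> F \<omega> else 0)"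
      using AE_finite
    proof eventually_elim
      case (elim \<omega>)
      show ?case
      proof (cases "0 < F \<omega>")
        case True
        note pos = young_right_deriv_pos(1)[OF N True]
        \<comment> \<open>The subgradient is taken at the starting value F(\<omega>), so one slope
          serves all neighbours \<eta>. Replacing F(\<eta>) by its positive part only shortens a
          decrease from F(\<omega>) > 0.\<close>
        have key: "?G \<omega> - ?G \<eta> \<le> right_deriv N (F \<omega>) * \<bar>F \<omega> - F \<eta>\<bar>" for \<eta>
        proof -
          have "?G \<omega> - ?G \<eta> \<le> right_deriv N (F \<omega>) * (F \<omega> - max 0 (F \<eta>))"
            using N convex_right_deriv_subgradient[of N "F \<omega>" "max 0 (F \<eta>)"] True
            by (simp add: young_function_def algebra_simps)
          also have "\<dots> \<le> right_deriv N (F \<omega>) * \<bar>F \<omega> - F \<eta>\<bar>"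
            using pos by (intro mult_left_mono) auto
          finally show ?thesis .
        qed
        have "D ?G x \<omega> \<le> right_deriv N (F \<omega>) * \<bar>D F x \<omega>\<bar>" for x
          by (simp add: D_def key)
        moreover have "0 \<le> right_deriv N (F \<omega>) * \<bar>D F x \<omega>\<bar>" for x
          using pos by simp
        ultimately have "D_plus ?G x \<omega> \<le> right_deriv N (F \<omega>) * \<bar>D F x \<omega>\<bar>" for x
          by (simp add: D_plus_def)
        then have "grad_plus_norm p \<sigma> ?G \<omega> \<le> ennreal (right_deriv N (F \<omega>)) * grad_norm p \<sigma> F \<omega>"
          using pos by (intro grad_plus_norm_le[OF F G elim p]) simp_all
        then show ?thesis using True by simp
      next
        case False
        then have "D_plus ?G x \<omega> = 0" for x
          by (auto simp: D_plus_def D_def N0)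
        then show ?thesis using p by (simp add: grad_plus_norm_def)
      qed
    qed
  qed
  finally show ?thesis .
qed

lemma young_modular_bounded:
  assumes N: "young_function N" and C: "1 \<le> C" "\<And>x y. 0 < x \<Longrightarrow> right_deriv N x * y \<le> N y + (C - 1) * N x"
    and p: "1 \<le> p" and k: "k_plus p \<sigma> \<pi> = ennreal k" "0 < k"
    and F [measurable]: "F \<in> borel_measurable \<pi>" and m: "is_median \<pi> F 0" and b: "\<And>\<omega>. \<bar>F \<omega>\<bar> \<le> b"
  shows "(\<integral>\<^sup>+\<omega>. ennreal (N (F \<omega>)) \<partial>\<pi>) \<le>
    (\<integral>\<^sup>+\<omega>. young_ext N (enn2ereal (ennreal (C / k) * grad_norm p \<sigma> F \<omega>)) \<partial>\<pi>)"
proof -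
  note [measurable] = borel_measurable_young[OF N]
  have N0: "N 0 = 0" "0 \<le> N x" "N (- x) = N x" for x
    using N by (auto simp: young_function_def)
  define w where "w F \<omega> = (if 0 < F \<omega> then ennreal (right_deriv N (F \<omega>)) * grad_norm p \<sigma> F \<omega> else 0)"
    for F \<omega>
  define a where "a = (\<integral>\<^sup>+\<omega>. ennreal (N (F \<omega>)) \<partial>\<pi>)"
  have "a \<le> (\<integral>\<^sup>+\<omega>. ennreal (N b) \<partial>\<pi>)"
    unfolding a_def using b by (intro nn_integral_mono ennreal_leI young_mono[OF N]) (meson abs_ge_self order_trans)
  also have "\<dots> < \<infinity>"
    using emeasure_space_1 by simp
  finally have fin: "a < \<infinity>" .
  \<comment> \<open>The integrals of the two gradient terms can be added once each is represented by
    a measurable minorant with the same integral.\<close>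
  obtain g1 where g1 [measurable]: "g1 \<in> borel_measurable \<pi>" and g1_le: "\<And>\<omega>. g1 \<omega> \<le> w F \<omega>"
    and int1: "(\<integral>\<^sup>+\<omega>. g1 \<omega> \<partial>\<pi>) = (\<integral>\<^sup>+\<omega>. w F \<omega> \<partial>\<pi>)"
    using nn_integral_minorant[of \<pi> "w F"] by blast
  obtain g2 where g2 [measurable]: "g2 \<in> borel_measurable \<pi>" and g2_le: "\<And>\<omega>. g2 \<omega> \<le> w (\<lambda>\<omega>. - F \<omega>) \<omega>"
    and int2: "(\<integral>\<^sup>+\<omega>. g2 \<omega> \<partial>\<pi>) = (\<integral>\<^sup>+\<omega>. w (\<lambda>\<omega>. - F \<omega>) \<omega> \<partial>\<pi>)"
    using nn_integral_minorant[of \<pi> "w (\<lambda>\<omega>. - F \<omega>)"] by blast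
  have "a = (\<integral>\<^sup>+\<omega>. ennreal (N (max 0 (F \<omega>))) + ennreal (N (max 0 (- F \<omega>))) \<partial>\<pi>)"
    unfolding a_def by (intro nn_integral_cong) (auto simp: max_def N0)
  also have "\<dots> = (\<integral>\<^sup>+\<omega>. ennreal (N (max 0 (F \<omega>))) \<partial>\<pi>) + (\<integral>\<^sup>+\<omega>. ennreal (N (max 0 (- F \<omega>))) \<partial>\<pi>)"
    by (rule nn_integral_add) measurable
  finally have "ennreal k * a \<le> (\<integral>\<^sup>+\<omega>. w F \<omega> \<partial>\<pi>) + (\<integral>\<^sup>+\<omega>. w (\<lambda>\<omega>. - F \<omega>) \<omega> \<partial>\<pi>)"
    using k_plus_times_young_le[OF N p F m, of b] k_plus_times_young_le[OF N p, of "\<lambda>\<omega>. - F \<omega>" b] b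
      is_median_zero_uminus[OF m]
    unfolding w_def k(1) by (auto simp: distrib_left abs_le_iff intro!: add_mono)
  also have "\<dots> = (\<integral>\<^sup>+\<omega>. g1 \<omega> + g2 \<omega> \<partial>\<pi>)"
    by (simp add: int1[symmetric] int2[symmetric] nn_integral_add)
  finally have ka: "ennreal k * a \<le> (\<integral>\<^sup>+\<omega>. g1 \<omega> + g2 \<omega> \<partial>\<pi>)" .
  let ?Y = "\<lambda>\<omega>. young_ext N (enn2ereal (ennreal (C / k) * grad_norm p \<sigma> F \<omega>))"
  \<comment> \<open>\<open>young_const_bound\<close> at y = (C/k) |DF|; the factor 1/k is chosen to
    cancel the k in \<open>ka\<close>.\<close>
  have young: "ennreal (C / k) * (ennreal (right_deriv N \<bar>F \<omega>\<bar>) * grad_norm p \<sigma> F \<omega>) \<le>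
      ?Y \<omega> + ennreal ((C - 1) * N (F \<omega>))" if "F \<omega> \<noteq> 0" for \<omega>
  proof (cases "grad_norm p \<sigma> F \<omega>")
    case (real r)
    have "N \<bar>F \<omega>\<bar> = N (F \<omega>)" by (auto simp: abs_if N0)
    then have "C / k * (right_deriv N \<bar>F \<omega>\<bar> * r) \<le> N (C / k * r) + (C - 1) * N (F \<omega>)"
      using C(2)[of "\<bar>F \<omega>\<bar>" "C / k * r"] that by (simp add: mult_ac)
    then show ?thesis
      using real C(1) k(2) N0 young_right_deriv_pos(1)[OF N, of "\<bar>F \<omega>\<bar>"] that
      by (simp add: ennreal_mult[symmetric] young_ext_ereal ennreal_plus[symmetric] ennreal_leI del: ennreal_plus)
  next
    case top
    then show ?thesis using C(1) k(2) by (simp add: ennreal_mult_top young_ext_infinity)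
  qed
  define u where "u \<omega> = ennreal (C / k) * (g1 \<omega> + g2 \<omega>)" for \<omega>
  \<comment> \<open>The \<open>ennreal\<close> difference is cut off at 0. It is measurable and
    still below \<open>?Y\<close>, so the integral of v + (C - 1) N(F) splits even if
    \<open>?Y\<close> is not measurable.\<close>
  define v where "v \<omega> = u \<omega> - ennreal ((C - 1) * N (F \<omega>))" for \<omega>
  have [measurable]: "u \<in> borel_measurable \<pi>" unfolding u_def by measurable
  have [measurable]: "v \<in> borel_measurable \<pi>" unfolding v_def by measurable
  \<comment> \<open>At each \<omega> at most one of g1 and g2 is non-zero, the sign of F deciding
    which; both terms therefore combine to the slope at |F|.\<close>
  have u_le: "u \<omega> \<le> ?Y \<omega> + ennreal ((C - 1) * N (F \<omega>))" for \<omega>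
  proof -
    have "F \<omega> = 0 \<Longrightarrow> u \<omega> = 0" and
      "F \<omega> \<noteq> 0 \<Longrightarrow> u \<omega> \<le> ennreal (C / k) * (ennreal (right_deriv N \<bar>F \<omega>\<bar>) * grad_norm p \<sigma> F \<omega>)"
      unfolding u_def using g1_le[of \<omega>] g2_le[of \<omega>]
      by (auto simp: w_def grad_norm_uminus abs_if intro!: mult_left_mono split: if_splits)
    then show ?thesis using young[of \<omega>] by (cases "F \<omega> = 0") (auto intro: order_trans)
  qed
  have "v \<omega> \<le> ?Y \<omega>" for \<omega>
    unfolding v_def using u_le[of \<omega>] by (simp add: ennreal_minus_le_iff add.commute)
  then have vY: "(\<integral>\<^sup>+\<omega>. v \<omega> \<partial>\<pi>) \<le> (\<integral>\<^sup>+\<omega>. ?Y \<omega> \<partial>\<pi>)"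
    by (intro nn_integral_mono)
  have "ennreal C * a = ennreal (C / k) * (ennreal k * a)"
    using k(2) C(1) by (simp add: mult.assoc[symmetric] ennreal_mult[symmetric])
  also have "\<dots> \<le> ennreal (C / k) * (\<integral>\<^sup>+\<omega>. g1 \<omega> + g2 \<omega> \<partial>\<pi>)"
    using ka by (rule mult_left_mono) simp
  also have "\<dots> = (\<integral>\<^sup>+\<omega>. u \<omega> \<partial>\<pi>)"
    unfolding u_def by (simp add: nn_integral_cmult)
  also have "\<dots> \<le> (\<integral>\<^sup>+\<omega>. v \<omega> + ennreal ((C - 1) * N (F \<omega>)) \<partial>\<pi>)"
    unfolding v_def
    by (intro nn_integral_mono) (metis add.commute diff_add_cancel_ennreal linear add_increasing2 zero_le order_refl order_trans le_add2)
  also have "\<dots> = (\<integral>\<^sup>+\<omega>. v \<omega> \<partial>\<pi>) + ennreal (C - 1) * a"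
    unfolding a_def using C(1) N0 by (simp add: nn_integral_add ennreal_mult nn_integral_cmult)
  finally have le: "ennreal C * a \<le> (\<integral>\<^sup>+\<omega>. v \<omega> \<partial>\<pi>) + ennreal (C - 1) * a" .
  \<comment> \<open>Cancelling (C - 1) a is legitimate because a is finite; this is where the
    boundedness of \<open>F\<close> enters.\<close>
  have "a \<le> (\<integral>\<^sup>+\<omega>. v \<omega> \<partial>\<pi>)"
  proof -
    obtain r where r: "a = ennreal r" "0 \<le> r" using fin by (cases a) auto
    show ?thesis
    proof (cases "\<integral>\<^sup>+\<omega>. v \<omega> \<partial>\<pi>")
      case (real s)
      then have "C * r \<le> s + (C - 1) * r"
        using le C(1) r by (simp add: ennreal_mult[symmetric] ennreal_plus[symmetric] ennreal_le_iff del: ennreal_plus)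
      then show ?thesis using real r by (simp add: algebra_simps ennreal_leI)
    qed simp
  qed
  with vY show ?thesis unfolding a_def by (rule order_trans[rotated])
qed

lemma young_modular:
  assumes N: "young_function N" and C: "1 \<le> C" "\<And>x y. 0 < x \<Longrightarrow> right_deriv N x * y \<le> N y + (C - 1) * N x"
    and p: "1 \<le> p" and k: "k_plus p \<sigma> \<pi> = ennreal k" "0 < k"
    and F [measurable]: "F \<in> borel_measurable \<pi>" and m: "is_median \<pi> F 0"
  shows "(\<integral>\<^sup>+\<omega>. ennreal (N (F \<omega>)) \<partial>\<pi>) \<le>
    (\<integral>\<^sup>+\<omega>. young_ext N (enn2ereal (ennreal (C / k) * grad_norm p \<sigma> F \<omega>)) \<partial>\<pi>)"
    (is "_ \<le> ?R")
proof -
  note [measurable] = borel_measurable_young[OF N]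
  \<comment> \<open>The level \<open>Suc j\<close> is positive even for j = 0, so \<open>T j\<close>
    has the same sign as \<open>F\<close> and keeps the median 0.\<close>
  define T where "T j \<omega> = max (- real (Suc j)) (min (F \<omega>) (real (Suc j)))" for j \<omega>
  have T [measurable]: "T j \<in> borel_measurable \<pi>" for j
    unfolding T_def by measurable
  have le: "(\<integral>\<^sup>+\<omega>. ennreal (N (T j \<omega>)) \<partial>\<pi>) \<le> ?R" for j
  proof -
    have "(\<integral>\<^sup>+\<omega>. ennreal (N (T j \<omega>)) \<partial>\<pi>) \<le>
        (\<integral>\<^sup>+\<omega>. young_ext N (enn2ereal (ennreal (C / k) * grad_norm p \<sigma> (T j) \<omega>)) \<partial>\<pi>)"
    proof (rule young_modular_bounded[OF N C p k])
      show "is_median \<pi> (T j) 0"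
        by (rule is_median_zero_cong[OF m]) (auto simp: T_def max_def min_def)
      show "\<bar>T j \<omega>\<bar> \<le> real (Suc j)" for \<omega>
        by (auto simp: T_def)
    qed simp_all
    also have "\<dots> \<le> ?R"
    proof (rule nn_integral_mono_AE)
      show "AE \<omega> in \<pi>. young_ext N (enn2ereal (ennreal (C / k) * grad_norm p \<sigma> (T j) \<omega>)) \<le>
          young_ext N (enn2ereal (ennreal (C / k) * grad_norm p \<sigma> F \<omega>))"
        using AE_finite
      proof eventually_elim
        case (elim \<omega>)
        have "\<bar>D (T j) x \<omega>\<bar> \<le> 1 * \<bar>D F x \<omega>\<bar>" for x
          by (auto simp: D_def T_def max_def min_def)
        from grad_norm_le[OF F T elim p _ this] have "grad_norm p \<sigma> (T j) \<omega> \<le> grad_norm p \<sigma> F \<omega>"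
          by simp
        then show ?case
          by (intro young_ext_mono[OF N] mult_left_mono) auto
      qed
    qed
    finally show ?thesis .
  qed
  have "ennreal (N (F \<omega>)) \<le> (SUP j. ennreal (N (T j \<omega>)))" for \<omega>
  proof -
    obtain j where "\<bar>F \<omega>\<bar> \<le> real j" using real_arch_simple by blast
    then have "T j \<omega> = F \<omega>" by (auto simp: T_def)
    then show ?thesis by (metis SUP_upper UNIV_I)
  qed
  then have "(\<integral>\<^sup>+\<omega>. ennreal (N (F \<omega>)) \<partial>\<pi>) \<le> (\<integral>\<^sup>+\<omega>. (SUP j. ennreal (N (T j \<omega>))) \<partial>\<pi>)"
    by (intro nn_integral_mono)
  also have "\<dots> = (SUP j. \<integral>\<^sup>+\<omega>. ennreal (N (T j \<omega>)) \<partial>\<pi>)"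
  proof (rule nn_integral_monotone_convergence_SUP)
    show "incseq (\<lambda>j \<omega>. ennreal (N (T j \<omega>)))"
      by (intro monoI le_funI ennreal_leI young_mono[OF N]) (auto simp: T_def max_def min_def)
  qed measurable
  also have "\<dots> \<le> ?R"
    using le by (rule SUP_least)
  finally show ?thesis .
qed

lemma orlicz_norm_le:
  assumes N: "young_function N" and C: "1 \<le> C" "\<And>x y. 0 < x \<Longrightarrow> right_deriv N x * y \<le> N y + (C - 1) * N x"
    and p: "1 \<le> p" and k: "k_plus p \<sigma> \<pi> = ennreal k" "0 < k"
    and F [measurable]: "F \<in> borel_measurable \<pi>" and m: "is_median \<pi> F 0"
  shows "orlicz_norm N \<pi> (\<lambda>\<omega>. ereal (F \<omega>)) \<le>
    ennreal (C / k) * orlicz_norm N \<pi> (\<lambda>\<omega>. enn2ereal (grad_norm p \<sigma> F \<omega>))"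
    (is "?L \<le> _")
proof -
  define c where "c = C / k"
  have c: "0 < c" unfolding c_def using C k by simp
  have *: "?L \<le> ennreal c * ennreal l"
    if l: "0 < l" "(\<integral>\<^sup>+\<omega>. young_ext N (enn2ereal (grad_norm p \<sigma> F \<omega>) / ereal l) \<partial>\<pi>) \<le> 1" for l
  proof -
    \<comment> \<open>After division by c * l the factor c of the modular inequality cancels,
      leaving the gradient norm of \<open>F\<close> divided by l, for which l is admissible by
      assumption.\<close>
    let ?G = "\<lambda>\<omega>. F \<omega> / (c * l)"
    have cl: "0 < c * l" using c l(1) by (rule mult_pos_pos)
    have G: "?G \<in> borel_measurable \<pi>" by measurable
    have "is_median \<pi> ?G 0"
      using cl by (intro is_median_zero_cong[OF m]) (simp_all add: divide_le_0_iff zero_le_divide_iff not_le not_less)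
    then have "(\<integral>\<^sup>+\<omega>. ennreal (N (?G \<omega>)) \<partial>\<pi>) \<le> (\<integral>\<^sup>+\<omega>. young_ext N (enn2ereal (ennreal c * grad_norm p \<sigma> ?G \<omega>)) \<partial>\<pi>)"
      by (intro young_modular[OF N C p k G, folded c_def])
    also have "\<dots> \<le> (\<integral>\<^sup>+\<omega>. young_ext N (enn2ereal (grad_norm p \<sigma> F \<omega>) / ereal l) \<partial>\<pi>)"
    proof (rule nn_integral_mono_AE)
      show "AE \<omega> in \<pi>. young_ext N (enn2ereal (ennreal c * grad_norm p \<sigma> ?G \<omega>)) \<le>
          young_ext N (enn2ereal (grad_norm p \<sigma> F \<omega>) / ereal l)"
        using AE_finite
      proof eventually_elim
        case (elim \<omega>)
        have "\<bar>D ?G x \<omega>\<bar> \<le> 1 / (c * l) * \<bar>D F x \<omega>\<bar>" for x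
          using cl by (simp add: D_def diff_divide_distrib[symmetric] abs_divide)
        then have "grad_norm p \<sigma> ?G \<omega> \<le> ennreal (1 / (c * l)) * grad_norm p \<sigma> F \<omega>"
          using cl by (intro grad_norm_le[OF F G elim p]) auto
        then have "ennreal c * grad_norm p \<sigma> ?G \<omega> \<le> ennreal c * (ennreal (1 / (c * l)) * grad_norm p \<sigma> F \<omega>)"
          by (rule mult_left_mono) simp
        also have "\<dots> = ennreal (1 / l) * grad_norm p \<sigma> F \<omega>"
          using c l cl by (simp add: mult.assoc[symmetric] ennreal_mult[symmetric])
        finally have "young_ext N (enn2ereal (ennreal c * grad_norm p \<sigma> ?G \<omega>)) \<le>
            young_ext N (enn2ereal (ennreal (1 / l) * grad_norm p \<sigma> F \<omega>))"
          by (rule young_ext_mono[OF N])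
        also have "enn2ereal (ennreal (1 / l) * grad_norm p \<sigma> F \<omega>) = enn2ereal (grad_norm p \<sigma> F \<omega>) / ereal l"
          using l by (simp add: times_ennreal.rep_eq enn2ereal_ennreal divide_ereal_def mult.commute inverse_eq_divide)
        finally show ?case .
      qed
    qed
    also note l(2)
    finally have "(\<integral>\<^sup>+\<omega>. young_ext N (ereal (F \<omega>) / ereal (c * l)) \<partial>\<pi>) \<le> 1"
      using c l(1) by (simp add: young_ext_ereal)
    then have "?L \<le> ennreal (c * l)"
      unfolding orlicz_norm_def using cl by (intro Inf_lower) blast
    then show ?thesis using c l by (simp add: ennreal_mult)
  qed
  \<comment> \<open>Moving c to the left frees the infimum, so that each admissible l can be tested
    separately.\<close>
  have "?L / ennreal c \<le> orlicz_norm N \<pi> (\<lambda>\<omega>. enn2ereal (grad_norm p \<sigma> F \<omega>))"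
    unfolding orlicz_norm_def[of N \<pi> "\<lambda>\<omega>. enn2ereal (grad_norm p \<sigma> F \<omega>)"]
  proof (rule Inf_greatest)
    fix y assume "y \<in> {ennreal l |l. 0 < l \<and> (\<integral>\<^sup>+\<omega>. young_ext N (enn2ereal (grad_norm p \<sigma> F \<omega>) / ereal l) \<partial>\<pi>) \<le> 1}"
    then have "?L \<le> ennreal c * y" using * by blast
    then show "?L / ennreal c \<le> y"
      using c by (metis divide_le_posI_ennreal ennreal_less_zero_iff mult.commute)
  qed
  then have "ennreal c * (?L / ennreal c) \<le> ennreal c * orlicz_norm N \<pi> (\<lambda>\<omega>. enn2ereal (grad_norm p \<sigma> F \<omega>))"
    by (rule mult_left_mono) simp
  moreover have "ennreal c * (?L / ennreal c) = ?L"
    using c by (simp add: ennreal_times_divide mult.commute[of "ennreal c"] mult_divide_eq_ennreal)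
  ultimately show ?thesis unfolding c_def by simp
qed

text \<open>Serves the case k_p^+ = 0, where the right-hand side is top times this norm and hence
  infinite as soon as the norm is non-zero.\<close>

lemma orlicz_norm_grad_pos:
  assumes N: "young_function N" and p: "1 \<le> p"
    and F: "F \<in> borel_measurable \<pi>" and nc: "\<not> (\<exists>c. AE \<omega> in \<pi>. F \<omega> = c)"
  shows "0 < orlicz_norm N \<pi> (\<lambda>\<omega>. enn2ereal (grad_norm p \<sigma> F \<omega>))"
proof -
  obtain e A where e: "0 < e" and A: "A \<in> sets \<pi>" "0 < prob A"
    and large: "\<And>\<omega>. \<omega> \<in> A \<Longrightarrow> finite \<omega> \<and> (\<exists>x\<in>\<omega>. e \<le> \<bar>D F x \<omega>\<bar>)"
    using not_AE_const_imp_large_gradient[OF F nc] by blast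
  have grad: "ennreal (e / 2) \<le> grad_norm p \<sigma> F \<omega>" if \<omega>: "\<omega> \<in> A" for \<omega>
  proof -
    obtain x where "x \<in> \<omega>" "e \<le> \<bar>D F x \<omega>\<bar>" "finite \<omega>" using large[OF \<omega>] by blast
    then have "ennreal (e / 2) \<le> ennreal (\<bar>D F x \<omega>\<bar> / 2)"
      by (intro ennreal_leI) simp
    then show ?thesis
      using grad_norm_ge_jump[OF p \<open>finite \<omega>\<close> \<open>x \<in> \<omega>\<close>, of F] by (rule order_trans)
  qed
  have N1: "0 < N 1" using N by (simp add: young_function_def)
  \<comment> \<open>On \<open>A\<close> the gradient norm is at least e/2. If l < e/2, then s =
    e/(2l) exceeds 1 and N(s) >= N(1) s, so a modular of at most 1 forces N(1) s P(A) <= 1, which is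
    the second bound on l.\<close>
  define d where "d = min (e / 2) (N 1 * (e / 2) * prob A)"
  have "ennreal d \<le> orlicz_norm N \<pi> (\<lambda>\<omega>. enn2ereal (grad_norm p \<sigma> F \<omega>))"
    unfolding orlicz_norm_def
  proof (rule Inf_greatest, clarify)
    fix l :: real assume l: "0 < l" "(\<integral>\<^sup>+\<omega>. young_ext N (enn2ereal (grad_norm p \<sigma> F \<omega>) / ereal l) \<partial>\<pi>) \<le> 1"
    have "d \<le> l"
    proof (cases "e / 2 \<le> l")
      case False
      define s where "s = e / 2 / l"
      have large: "1 \<le> s" and s: "0 < s" "e / 2 = l * s"
        using False l e by (simp_all add: s_def)
      have "ennreal (N 1 * (s) * prob A) = (\<integral>\<^sup>+\<omega>. ennreal (N 1 * (s)) * indicator A \<omega> \<partial>\<pi>)"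
        using A N1 s by (simp add: nn_integral_cmult_indicator emeasure_eq_measure ennreal_mult)
      also have "\<dots> \<le> (\<integral>\<^sup>+\<omega>. young_ext N (enn2ereal (grad_norm p \<sigma> F \<omega>) / ereal l) \<partial>\<pi>)"
      proof (intro nn_integral_mono)
        fix \<omega>
        have "ennreal (N 1 * (s)) \<le> young_ext N (enn2ereal (grad_norm p \<sigma> F \<omega>) / ereal l)" if "\<omega> \<in> A"
        proof -
          have "ennreal (N 1 * (s)) \<le> young_ext N (enn2ereal (ennreal (s)))"
            using large young_ge_linear[OF N large] s by (simp add: young_ext_ereal ennreal_leI)
          also have "\<dots> \<le> young_ext N (enn2ereal (ennreal (1 / l) * grad_norm p \<sigma> F \<omega>))"
          proof (rule young_ext_mono[OF N])
            have "ennreal (s) = ennreal (1 / l) * ennreal (e / 2)"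
              using l s by (simp add: ennreal_mult[symmetric])
            also have "\<dots> \<le> ennreal (1 / l) * grad_norm p \<sigma> F \<omega>"
              using grad[OF that] by (rule mult_left_mono) simp
            finally show "ennreal (s) \<le> ennreal (1 / l) * grad_norm p \<sigma> F \<omega>" .
          qed
          also have "enn2ereal (ennreal (1 / l) * grad_norm p \<sigma> F \<omega>) = enn2ereal (grad_norm p \<sigma> F \<omega>) / ereal l"
            using l by (simp add: times_ennreal.rep_eq enn2ereal_ennreal divide_ereal_def mult.commute inverse_eq_divide)
          finally show ?thesis .
        qed
        then show "ennreal (N 1 * (s)) * indicator A \<omega> \<le> young_ext N (enn2ereal (grad_norm p \<sigma> F \<omega>) / ereal l)"
          by (auto split: split_indicator)
      qed
      also have "\<dots> \<le> 1" by (rule l(2))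
      finally have "l * (N 1 * s * prob A) \<le> l * 1"
        using l(1) by (intro mult_left_mono) simp_all
      then show ?thesis unfolding d_def s(2) by (simp add: mult_ac)
    qed (simp add: d_def)
    then show "ennreal d \<le> ennreal l" by (rule ennreal_leI)
  qed
  moreover have "0 < ennreal d" using e A N1 by (simp add: d_def)
  ultimately show ?thesis by (rule less_le_trans[rotated])
qed

text \<open>The modular counterpart for k_p^+ = 0: on an event of positive probability the gradient
  norm is non-zero, so its multiple by top is infinite and \<open>young_ext\<close> takes the value
  top there.\<close>

lemma modular_infinite_multiple:
  assumes p: "1 \<le> p"
    and F: "F \<in> borel_measurable \<pi>" and nc: "\<not> (\<exists>c. AE \<omega> in \<pi>. F \<omega> = c)"
  shows "(\<integral>\<^sup>+\<omega>. young_ext N (enn2ereal (\<top> * grad_norm p \<sigma> F \<omega>)) \<partial>\<pi>) = \<top>"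
proof -
  obtain e A where e: "0 < e" and A: "A \<in> sets \<pi>" "0 < prob A"
    and large: "\<And>\<omega>. \<omega> \<in> A \<Longrightarrow> finite \<omega> \<and> (\<exists>x\<in>\<omega>. e \<le> \<bar>D F x \<omega>\<bar>)"
    using not_AE_const_imp_large_gradient[OF F nc] by blast
  have "\<top> = (\<integral>\<^sup>+\<omega>. \<top> * indicator A \<omega> \<partial>\<pi>)"
    using A by (subst nn_integral_cmult_indicator) (auto simp: emeasure_eq_measure ennreal_top_mult)
  also have "\<dots> \<le> (\<integral>\<^sup>+\<omega>. young_ext N (enn2ereal (\<top> * grad_norm p \<sigma> F \<omega>)) \<partial>\<pi>)"
  proof (intro nn_integral_mono)
    fix \<omega>
    have "grad_norm p \<sigma> F \<omega> \<noteq> 0" if \<omega>: "\<omega> \<in> A"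
    proof -
      obtain x where "x \<in> \<omega>" "e \<le> \<bar>D F x \<omega>\<bar>" "finite \<omega>" using large[OF \<omega>] by blast
      then show ?thesis
        using grad_norm_ge_jump[OF p, of \<omega> x F] e by auto
    qed
    then show "\<top> * indicator A \<omega> \<le> young_ext N (enn2ereal (\<top> * grad_norm p \<sigma> F \<omega>))"
      by (auto simp: ennreal_top_mult young_ext_infinity split: split_indicator)
  qed
  finally show ?thesis by (simp add: top_unique)
qed

lemma young_function_inequalities:
  assumes p: "1 \<le> p" and N: "young_function N" and C: "young_const N < \<infinity>"
    and F [measurable]: "F \<in> borel_measurable \<pi>" and m: "is_median \<pi> F 0"
  shows "orlicz_norm N \<pi> (\<lambda>\<omega>. ereal (F \<omega>))
      \<le> young_const N / k_plus p \<sigma> \<pi> * orlicz_norm N \<pi> (\<lambda>\<omega>. enn2ereal (grad_norm p \<sigma> F \<omega>))" (is ?orlicz)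
    and "(\<integral>\<^sup>+\<omega>. ennreal (N (F \<omega>)) \<partial>\<pi>)
      \<le> (\<integral>\<^sup>+\<omega>. young_ext N (enn2ereal (young_const N / k_plus p \<sigma> \<pi> * grad_norm p \<sigma> F \<omega>)) \<partial>\<pi>)" (is ?modular)
proof -
  obtain C where C: "young_const N = ennreal C" "1 \<le> C"
    "\<And>x y. 0 < x \<Longrightarrow> right_deriv N x * y \<le> N y + (C - 1) * N x"
    using young_const_bound[OF N C] by blast
  have "?orlicz \<and> ?modular"
  \<comment> \<open>Constant variables are settled before k_p^+ is examined. If \<sigma> = 0, every
    variable is almost surely constant and the infimum of the empty set is top; a non-constant
    \<open>F\<close> therefore excludes \<sigma> = 0 and gives a finite k_p^+.\<close>
  proof (cases "\<exists>c. AE \<omega> in \<pi>. F \<omega> = c")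
    case True
    then have zero: "AE \<omega> in \<pi>. F \<omega> = 0"
      using is_median_AE_const[OF F m] by blast
    have N0: "N 0 = 0" using N by (simp add: young_function_def)
    have *: "(\<integral>\<^sup>+\<omega>. young_ext N (ereal (F \<omega>) / ereal l) \<partial>\<pi>) = 0" if "0 < l" for l
    proof -
      have "(\<integral>\<^sup>+\<omega>. young_ext N (ereal (F \<omega>) / ereal l) \<partial>\<pi>) = (\<integral>\<^sup>+\<omega>. 0 \<partial>\<pi>)"
        using zero by (intro nn_integral_cong_AE) (auto simp: young_ext_def N0 that)
      then show ?thesis by simp
    qed
    have "orlicz_norm N \<pi> (\<lambda>\<omega>. ereal (F \<omega>)) \<le> ennreal l" if "0 < l" for l
      unfolding orlicz_norm_def using *[OF that] that by (intro Inf_lower) (auto intro!: exI[of _ l])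
    then have "orlicz_norm N \<pi> (\<lambda>\<omega>. ereal (F \<omega>)) \<le> 0"
      by - (rule ennreal_le_epsilon, simp)
    moreover have "(\<integral>\<^sup>+\<omega>. ennreal (N (F \<omega>)) \<partial>\<pi>) = (\<integral>\<^sup>+\<omega>. 0 \<partial>\<pi>)"
      using zero by (intro nn_integral_cong_AE) (auto simp: N0)
    ultimately show ?thesis by simp
  next
    case nc: False
    have "emeasure \<sigma> UNIV \<noteq> 0"
    proof
      assume "emeasure \<sigma> UNIV = 0"
      then have "AE \<omega> in \<pi>. F \<omega> = F {}"
        using AE_empty by auto
      with nc show False by blast
    qed
    then have "k_plus p \<sigma> \<pi> < \<infinity>"
      using p by (rule k_plus_less_top)
    then obtain k where k: "k_plus p \<sigma> \<pi> = ennreal k" "0 \<le> k"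
      by (cases "k_plus p \<sigma> \<pi>") auto
    show ?thesis
    proof (cases "k = 0")
      case True
      then have "young_const N / k_plus p \<sigma> \<pi> = \<top>"
        using C k by (simp add: divide_ennreal_def ennreal_mult_top)
      then show ?thesis
        using orlicz_norm_grad_pos[OF N p F nc] modular_infinite_multiple[OF p F nc]
        by (simp add: ennreal_top_mult)
    next
      case False
      then have "0 < k" using k by simp
      moreover from this have "young_const N / k_plus p \<sigma> \<pi> = ennreal (C / k)"
        using C(1,2) k(1) by (simp add: divide_ennreal)
      ultimately show ?thesis
        using orlicz_norm_le[OF N C(2,3) p k(1) _ F m] young_modular[OF N C(2,3) p k(1) _ F m] by simp
    qed
  qed
  then show ?orlicz ?modular by auto
qed

end

theorem theorem7p1:
  fixes \<sigma> :: "'a::metric_space measure" and \<pi> :: "'a config measure"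
    and p :: ennreal and N :: "real \<Rightarrow> real" and F :: "'a config \<Rightarrow> real"
  assumes "sets \<sigma> = sets borel" and "finite_measure \<sigma>" and "diffuse \<sigma>"
    and "poisson_measure \<sigma> \<pi>"
    and "1 \<le> p"
    and "young_function N" and "young_const N < \<infinity>"
    and "F \<in> borel_measurable \<pi>" and "is_median \<pi> F 0"
  shows "orlicz_norm N \<pi> (\<lambda>\<omega>. ereal (F \<omega>))
           \<le> young_const N / k_plus p \<sigma> \<pi> * orlicz_norm N \<pi> (\<lambda>\<omega>. enn2ereal (grad_norm p \<sigma> F \<omega>))
       \<and> (\<integral>\<^sup>+\<omega>. ennreal (N (F \<omega>)) \<partial>\<pi>)
           \<le> (\<integral>\<^sup>+\<omega>. young_ext N (enn2ereal (young_const N / k_plus p \<sigma> \<pi> * grad_norm p \<sigma> F \<omega>)) \<partial>\<pi>)"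
proof -
  interpret poisson_process \<sigma> \<pi>
    using assms(1,2,4) by (rule poisson_process.intro)
  show ?thesis
    using young_function_inequalities[OF assms(5-9)] by simp
qed

end
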